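(* Let $I$ be the pullback shape category $\{\bullet\to\bullet\leftarrow\bullet\}$. Let $\mathcal{A}$ be the $2$-category generated by objects $X,L,A,B,C$; morphisms $f,g\colon X\to L$, $\lambda_0\colon L\to B$, $\lambda_1\colon L\to C$, $b\colon B\to A$, $c\colon C\to A$; and $2$-morphisms $\gamma_0\colon\lambda_0 f\Rightarrow\lambda_0 g$ and $\gamma_1\colon\lambda_1 f\Rightarrow\lambda_1 g$; subject to the relations $b\lambda_0=c\lambda_1$ and $b*\gamma_0=c*\gamma_1$. Let $F\colon I\to\mathcal{A}$ be the diagram $B\xrightarrow{b}A\xleftarrow{c}C$, and let $\lambda\colon\Delta L\Rightarrow F$ be the cone with components $\lambda_0$ at $B$, $\lambda_1$ at $C$ and $b\lambda_0=c\lambda_1$ at $A$ (with identity $2$-morphism components). Then $(L,\lambda)$ is $2$-terminal in the strict-slice of pseudo-cones over $F$, but it is not a pseudo-limit of $F$.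
   Context: $2$-categories and $2$-functors are strict; $*$ denotes horizontal composition (and whiskering) of $2$-morphisms and juxtaposition denotes vertical composition. "Generated by the data subject to relations" means the $2$-category freely generated by the listed objects, morphisms and $2$-morphisms, modulo the listed relations. The $1$-category $I$ is regarded as a $2$-category with only identity $2$-morphisms. A pseudo-natural transformation $\mu\colon F\Rightarrow G$ between $2$-functors $F,G\colon I\to\mathcal{A}$ consists of morphisms $\mu_i\colon Fi\to Gi$ for $i\in I$ and invertible $2$-morphisms $\mu_f\colon(Gf)\mu_i\Rightarrow\mu_j(Ff)$ for $f\colon i\to j$ in $I$, such that $\mu_{\mathrm{id}_i}=\mathrm{id}_{\mu_i}$, $\mu_{gf}=(\mu_g*Ff)(Gg*\mu_f)$ for composable $f,g$, and $\mu_g(G\alpha*\mu_i)=(\mu_j*F\alpha)\mu_f$ for every $2$-morphism $\alpha\colon f\Rightarrow g$ in $I$. A modification $\varphi\colon\mu\to\nu$ consists of $2$-morphisms $\varphi_i\colon\mu_i\Rightarrow\nu_i$ with $\nu_f(Gf*\varphi_i)=(\varphi_j*Ff)\mu_f$ for every $f\colon i\to j$. $\mathrm{Ps}[I,\mathcal{A}]$ is the $2$-category of $2$-functors, pseudo-natural transformations and modifications. $\Delta X$ is the constant $2$-functor at $X$; a pseudo-cone over $F$ is a pseudo-natural transformation $\Delta X\Rightarrow F$. A pseudo-limit of $F$ is a pair $(L,\lambda\colon\Delta L\Rightarrow F)$ with $\lambda$ a pseudo-cone such that for each $X\in\mathcal{A}$ the functor $\lambda_*\circ\Delta\colon\mathcal{A}(X,L)\to\mathrm{Ps}[I,\mathcal{A}](\Delta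 X,F)$, given by post-composition with $\lambda$, is an isomorphism of categories. The strict-slice of pseudo-cones over $F$ is the $2$-category whose objects are pairs $(X,\mu)$ with $\mu\colon\Delta X\Rightarrow F$ a pseudo-cone; morphisms $(X,\mu)\to(Y,\nu)$ are morphisms $f\colon X\to Y$ of $\mathcal{A}$ with $\nu\Delta f=\mu$; $2$-morphisms $f\Rightarrow g$ are $2$-morphisms $\alpha\colon f\Rightarrow g$ of $\mathcal{A}$ with $\nu*\Delta\alpha=\mathrm{id}_\mu$. An object $L$ of a $2$-category $\mathcal{B}$ is $2$-terminal if for all $X\in\mathcal{B}$ the category $\mathcal{B}(X,L)$ is isomorphic to the terminal category $\mathbb{1}$. *)

theory Defs
  imports "HOL-Library.FuncSet"
begin

section \<open>Categories and isomorphisms of categories\<close>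

text \<open>Compositions are written in applicative order: \<open>Cmp C g f\<close> is "first f, then g".
  All structure is given on carrier sets; nothing is assumed outside of them.\<close>

record ('a, 'b) category =
  Ob :: "'a set"
  Ar :: "'b set"
  Sr :: "'b \<Rightarrow> 'a"
  Tr :: "'b \<Rightarrow> 'a"
  Idt :: "'a \<Rightarrow> 'b"
  Cmp :: "'b \<Rightarrow> 'b \<Rightarrow> 'b"

definition is_functor ::
  "('a, 'b) category \<Rightarrow> ('c, 'd) category \<Rightarrow> ('a \<Rightarrow> 'c) \<Rightarrow> ('b \<Rightarrow> 'd) \<Rightarrow> bool" where
  "is_functor C D F0 F1 \<longleftrightarrow>
     (\<forall>x\<in>Ob C. F0 x \<in> Ob D) \<and>
     (\<forall>f\<in>Ar C. F1 f \<in> Ar D \<and> Sr D (F1 f) = F0 (Sr C f) \<and> Tr D (F1 f) = F0 (Tr C f)) \<and>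
     (\<forall>x\<in>Ob C. F1 (Idt C x) = Idt D (F0 x)) \<and>
     (\<forall>g\<in>Ar C. \<forall>f\<in>Ar C. Sr C g = Tr C f \<longrightarrow> F1 (Cmp C g f) = Cmp D (F1 g) (F1 f))"

definition is_cat_isomorphism ::
  "('a, 'b) category \<Rightarrow> ('c, 'd) category \<Rightarrow> ('a \<Rightarrow> 'c) \<Rightarrow> ('b \<Rightarrow> 'd) \<Rightarrow> bool" where
  "is_cat_isomorphism C D F0 F1 \<longleftrightarrow> is_functor C D F0 F1 \<and>
     (\<exists>G0 G1. is_functor D C G0 G1 \<and>
        (\<forall>x\<in>Ob C. G0 (F0 x) = x) \<and> (\<forall>f\<in>Ar C. G1 (F1 f) = f) \<and>
        (\<forall>y\<in>Ob D. F0 (G0 y) = y) \<and> (\<forall>g\<in>Ar D. F1 (G1 g) = g))"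

definition isomorphic_cats :: "('a, 'b) category \<Rightarrow> ('c, 'd) category \<Rightarrow> bool" where
  "isomorphic_cats C D \<longleftrightarrow> (\<exists>F0 F1. is_cat_isomorphism C D F0 F1)"

definition terminal_cat :: "(unit, unit) category" where
  "terminal_cat = \<lparr>Ob = UNIV, Ar = UNIV, Sr = id, Tr = id, Idt = id, Cmp = (\<lambda>_ _. ())\<rparr>"


section \<open>Strict 2-categories\<close>

record ('o, 'm, 'c) two_cat =
  Obj :: "'o set"
  Mor :: "'m set"
  Dom :: "'m \<Rightarrow> 'o"
  Cod :: "'m \<Rightarrow> 'o"
  Id1 :: "'o \<Rightarrow> 'm"
  Comp :: "'m \<Rightarrow> 'm \<Rightarrow> 'm"
  Cell :: "'c set"
  Src :: "'c \<Rightarrow> 'm"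
  Tgt :: "'c \<Rightarrow> 'm"
  Id2 :: "'m \<Rightarrow> 'c"
  VComp :: "'c \<Rightarrow> 'c \<Rightarrow> 'c"
  HComp :: "'c \<Rightarrow> 'c \<Rightarrow> 'c"

locale two_category =
  fixes A :: "('o, 'm, 'c) two_cat"
  assumes Dom_Obj: "f \<in> Mor A \<Longrightarrow> Dom A f \<in> Obj A"
    and Cod_Obj: "f \<in> Mor A \<Longrightarrow> Cod A f \<in> Obj A"
    and Id1_Mor: "x \<in> Obj A \<Longrightarrow> Id1 A x \<in> Mor A \<and> Dom A (Id1 A x) = x \<and> Cod A (Id1 A x) = x"
    and Comp_Mor: "\<lbrakk>f \<in> Mor A; g \<in> Mor A; Dom A g = Cod A f\<rbrakk> \<Longrightarrow>
      Comp A g f \<in> Mor A \<and> Dom A (Comp A g f) = Dom A f \<and> Cod A (Comp A g f) = Cod A g"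
    and Comp_Id1: "f \<in> Mor A \<Longrightarrow> Comp A f (Id1 A (Dom A f)) = f"
    and Id1_Comp: "f \<in> Mor A \<Longrightarrow> Comp A (Id1 A (Cod A f)) f = f"
    and Comp_assoc: "\<lbrakk>f \<in> Mor A; g \<in> Mor A; h \<in> Mor A; Dom A g = Cod A f; Dom A h = Cod A g\<rbrakk> \<Longrightarrow>
      Comp A (Comp A h g) f = Comp A h (Comp A g f)"
    and Src_Mor: "\<alpha> \<in> Cell A \<Longrightarrow> Src A \<alpha> \<in> Mor A"
    and Tgt_Mor: "\<alpha> \<in> Cell A \<Longrightarrow> Tgt A \<alpha> \<in> Mor A"
    and Cell_parallel: "\<alpha> \<in> Cell A \<Longrightarrow>
      Dom A (Src A \<alpha>) = Dom A (Tgt A \<alpha>) \<and> Cod A (Src A \<alpha>) = Cod A (Tgt A \<alpha>)"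
    and Id2_Cell: "f \<in> Mor A \<Longrightarrow> Id2 A f \<in> Cell A \<and> Src A (Id2 A f) = f \<and> Tgt A (Id2 A f) = f"
    and VComp_Cell: "\<lbrakk>\<alpha> \<in> Cell A; \<beta> \<in> Cell A; Src A \<beta> = Tgt A \<alpha>\<rbrakk> \<Longrightarrow>
      VComp A \<beta> \<alpha> \<in> Cell A \<and> Src A (VComp A \<beta> \<alpha>) = Src A \<alpha> \<and> Tgt A (VComp A \<beta> \<alpha>) = Tgt A \<beta>"
    and VComp_Id2: "\<alpha> \<in> Cell A \<Longrightarrow> VComp A \<alpha> (Id2 A (Src A \<alpha>)) = \<alpha>"
    and Id2_VComp: "\<alpha> \<in> Cell A \<Longrightarrow> VComp A (Id2 A (Tgt A \<alpha>)) \<alpha> = \<alpha>"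
    and VComp_assoc: "\<lbrakk>\<alpha> \<in> Cell A; \<beta> \<in> Cell A; \<gamma> \<in> Cell A; Src A \<beta> = Tgt A \<alpha>; Src A \<gamma> = Tgt A \<beta>\<rbrakk> \<Longrightarrow>
      VComp A (VComp A \<gamma> \<beta>) \<alpha> = VComp A \<gamma> (VComp A \<beta> \<alpha>)"
    and HComp_Cell: "\<lbrakk>\<alpha> \<in> Cell A; \<beta> \<in> Cell A; Dom A (Src A \<beta>) = Cod A (Src A \<alpha>)\<rbrakk> \<Longrightarrow>
      HComp A \<beta> \<alpha> \<in> Cell A \<and> Src A (HComp A \<beta> \<alpha>) = Comp A (Src A \<beta>) (Src A \<alpha>)
        \<and> Tgt A (HComp A \<beta> \<alpha>) = Comp A (Tgt A \<beta>) (Tgt A \<alpha>)"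
    and HComp_unit_right: "\<alpha> \<in> Cell A \<Longrightarrow> HComp A \<alpha> (Id2 A (Id1 A (Dom A (Src A \<alpha>)))) = \<alpha>"
    and HComp_unit_left: "\<alpha> \<in> Cell A \<Longrightarrow> HComp A (Id2 A (Id1 A (Cod A (Src A \<alpha>)))) \<alpha> = \<alpha>"
    and HComp_assoc: "\<lbrakk>\<alpha> \<in> Cell A; \<beta> \<in> Cell A; \<gamma> \<in> Cell A;
        Dom A (Src A \<beta>) = Cod A (Src A \<alpha>); Dom A (Src A \<gamma>) = Cod A (Src A \<beta>)\<rbrakk> \<Longrightarrow>
      HComp A (HComp A \<gamma> \<beta>) \<alpha> = HComp A \<gamma> (HComp A \<beta> \<alpha>)"
    and HComp_Id2: "\<lbrakk>f \<in> Mor A; g \<in> Mor A; Dom A g = Cod A f\<rbrakk> \<Longrightarrow>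
      HComp A (Id2 A g) (Id2 A f) = Id2 A (Comp A g f)"
    and interchange: "\<lbrakk>\<alpha> \<in> Cell A; \<alpha>' \<in> Cell A; \<beta> \<in> Cell A; \<beta>' \<in> Cell A;
        Src A \<alpha>' = Tgt A \<alpha>; Src A \<beta>' = Tgt A \<beta>; Dom A (Src A \<beta>) = Cod A (Src A \<alpha>)\<rbrakk> \<Longrightarrow>
      HComp A (VComp A \<beta>' \<beta>) (VComp A \<alpha>' \<alpha>) = VComp A (HComp A \<beta>' \<alpha>') (HComp A \<beta> \<alpha>)"

abbreviation wl :: "('o, 'm, 'c) two_cat \<Rightarrow> 'm \<Rightarrow> 'c \<Rightarrow> 'c" where
  "wl A h \<alpha> \<equiv> HComp A (Id2 A h) \<alpha>"

abbreviation wr :: "('o, 'm, 'c) two_cat \<Rightarrow> 'c \<Rightarrow> 'm \<Rightarrow> 'c" where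
  "wr A \<alpha> h \<equiv> HComp A \<alpha> (Id2 A h)"

definition invertible_cell :: "('o, 'm, 'c) two_cat \<Rightarrow> 'c \<Rightarrow> bool" where
  "invertible_cell A \<alpha> \<longleftrightarrow> \<alpha> \<in> Cell A \<and>
     (\<exists>\<beta>\<in>Cell A. Src A \<beta> = Tgt A \<alpha> \<and> Tgt A \<beta> = Src A \<alpha> \<and>
        VComp A \<beta> \<alpha> = Id2 A (Src A \<alpha>) \<and> VComp A \<alpha> \<beta> = Id2 A (Tgt A \<alpha>))"

definition hom_cat :: "('o, 'm, 'c) two_cat \<Rightarrow> 'o \<Rightarrow> 'o \<Rightarrow> ('m, 'c) category" where
  "hom_cat A x y =
     \<lparr>Ob = {f \<in> Mor A. Dom A f = x \<and> Cod A f = y},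
      Ar = {\<alpha> \<in> Cell A. Dom A (Src A \<alpha>) = x \<and> Cod A (Src A \<alpha>) = y},
      Sr = Src A, Tr = Tgt A, Idt = Id2 A, Cmp = VComp A\<rparr>"

definition two_terminal :: "('o, 'm, 'c) two_cat \<Rightarrow> 'o \<Rightarrow> bool" where
  "two_terminal B l \<longleftrightarrow> l \<in> Obj B \<and> (\<forall>x\<in>Obj B. isomorphic_cats (hom_cat B x l) terminal_cat)"

definition locally_discrete :: "('a, 'b) category \<Rightarrow> ('a, 'b, 'b) two_cat" where
  "locally_discrete C =
     \<lparr>Obj = Ob C, Mor = Ar C, Dom = Sr C, Cod = Tr C, Id1 = Idt C, Comp = Cmp C,
      Cell = Ar C, Src = id, Tgt = id, Id2 = id, VComp = (\<lambda>\<beta> \<alpha>. \<alpha>), HComp = Cmp C\<rparr>"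


section \<open>The 2-category of 2-functors, pseudo-natural transformations and modifications\<close>

text \<open>The component functions are required to be \<open>extensional\<close> (equal to \<open>undefined\<close> off the
  carriers), so that HOL equality is equality of 2-functors, of transformations and of
  modifications. Transformations and modifications carry their source and target.\<close>

record ('i, 'j, 'k, 'o, 'm, 'c) two_functor =
  F0 :: "'i \<Rightarrow> 'o"
  F1 :: "'j \<Rightarrow> 'm"
  F2 :: "'k \<Rightarrow> 'c"

record ('i, 'j, 'k, 'o, 'm, 'c) ps_nat =
  nsrc :: "('i, 'j, 'k, 'o, 'm, 'c) two_functor"
  ntgt :: "('i, 'j, 'k, 'o, 'm, 'c) two_functor"
  ncomp :: "'i \<Rightarrow> 'm"
  ncell :: "'j \<Rightarrow> 'c"

record ('i, 'j, 'k, 'o, 'm, 'c) modification =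
  msrc :: "('i, 'j, 'k, 'o, 'm, 'c) ps_nat"
  mtgt :: "('i, 'j, 'k, 'o, 'm, 'c) ps_nat"
  mcomp :: "'i \<Rightarrow> 'c"

definition is_two_functor ::
  "('i, 'j, 'k) two_cat \<Rightarrow> ('o, 'm, 'c) two_cat \<Rightarrow> ('i, 'j, 'k, 'o, 'm, 'c) two_functor \<Rightarrow> bool" where
  "is_two_functor I A F \<longleftrightarrow>
     F0 F \<in> Obj I \<rightarrow>\<^sub>E Obj A \<and> F1 F \<in> Mor I \<rightarrow>\<^sub>E Mor A \<and> F2 F \<in> Cell I \<rightarrow>\<^sub>E Cell A \<and>
     (\<forall>u\<in>Mor I. Dom A (F1 F u) = F0 F (Dom I u) \<and> Cod A (F1 F u) = F0 F (Cod I u)) \<and>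
     (\<forall>i\<in>Obj I. F1 F (Id1 I i) = Id1 A (F0 F i)) \<and>
     (\<forall>u\<in>Mor I. \<forall>v\<in>Mor I. Dom I v = Cod I u \<longrightarrow>
        F1 F (Comp I v u) = Comp A (F1 F v) (F1 F u)) \<and>
     (\<forall>\<alpha>\<in>Cell I. Src A (F2 F \<alpha>) = F1 F (Src I \<alpha>) \<and> Tgt A (F2 F \<alpha>) = F1 F (Tgt I \<alpha>)) \<and>
     (\<forall>u\<in>Mor I. F2 F (Id2 I u) = Id2 A (F1 F u)) \<and>
     (\<forall>\<alpha>\<in>Cell I. \<forall>\<beta>\<in>Cell I. Src I \<beta> = Tgt I \<alpha> \<longrightarrow>
        F2 F (VComp I \<beta> \<alpha>) = VComp A (F2 F \<beta>) (F2 F \<alpha>)) \<and>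
     (\<forall>\<alpha>\<in>Cell I. \<forall>\<beta>\<in>Cell I. Dom I (Src I \<beta>) = Cod I (Src I \<alpha>) \<longrightarrow>
        F2 F (HComp I \<beta> \<alpha>) = HComp A (F2 F \<beta>) (F2 F \<alpha>))"

definition is_ps_nat ::
  "('i, 'j, 'k) two_cat \<Rightarrow> ('o, 'm, 'c) two_cat \<Rightarrow> ('i, 'j, 'k, 'o, 'm, 'c) ps_nat \<Rightarrow> bool" where
  "is_ps_nat I A \<mu> \<longleftrightarrow> (let F = nsrc \<mu>; G = ntgt \<mu>; m = ncomp \<mu>; n = ncell \<mu> in
     is_two_functor I A F \<and> is_two_functor I A G \<and>
     m \<in> Obj I \<rightarrow>\<^sub>E Mor A \<and> n \<in> Mor I \<rightarrow>\<^sub>E Cell A \<and>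
     (\<forall>i\<in>Obj I. Dom A (m i) = F0 F i \<and> Cod A (m i) = F0 G i) \<and>
     (\<forall>u\<in>Mor I. invertible_cell A (n u) \<and>
        Src A (n u) = Comp A (F1 G u) (m (Dom I u)) \<and>
        Tgt A (n u) = Comp A (m (Cod I u)) (F1 F u)) \<and>
     (\<forall>i\<in>Obj I. n (Id1 I i) = Id2 A (m i)) \<and>
     (\<forall>u\<in>Mor I. \<forall>v\<in>Mor I. Dom I v = Cod I u \<longrightarrow>
        n (Comp I v u) = VComp A (wr A (n v) (F1 F u)) (wl A (F1 G v) (n u))) \<and>
     (\<forall>\<alpha>\<in>Cell I.
        VComp A (n (Tgt I \<alpha>)) (wr A (F2 G \<alpha>) (m (Dom I (Src I \<alpha>)))) =
        VComp A (wl A (m (Cod I (Src I \<alpha>))) (F2 F \<alpha>)) (n (Src I \<alpha>))))"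

definition is_modification ::
  "('i, 'j, 'k) two_cat \<Rightarrow> ('o, 'm, 'c) two_cat \<Rightarrow> ('i, 'j, 'k, 'o, 'm, 'c) modification \<Rightarrow> bool" where
  "is_modification I A \<phi> \<longleftrightarrow> (let \<mu> = msrc \<phi>; \<nu> = mtgt \<phi>; p = mcomp \<phi> in
     is_ps_nat I A \<mu> \<and> is_ps_nat I A \<nu> \<and> nsrc \<mu> = nsrc \<nu> \<and> ntgt \<mu> = ntgt \<nu> \<and>
     p \<in> Obj I \<rightarrow>\<^sub>E Cell A \<and>
     (\<forall>i\<in>Obj I. Src A (p i) = ncomp \<mu> i \<and> Tgt A (p i) = ncomp \<nu> i) \<and>
     (\<forall>u\<in>Mor I.
        VComp A (ncell \<nu> u) (wl A (F1 (ntgt \<mu>) u) (p (Dom I u))) =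
        VComp A (wr A (p (Cod I u)) (F1 (nsrc \<mu>) u)) (ncell \<mu> u)))"

definition ps_id ::
  "('i, 'j, 'k) two_cat \<Rightarrow> ('o, 'm, 'c) two_cat \<Rightarrow>
   ('i, 'j, 'k, 'o, 'm, 'c) two_functor \<Rightarrow> ('i, 'j, 'k, 'o, 'm, 'c) ps_nat" where
  "ps_id I A F = \<lparr>nsrc = F, ntgt = F,
     ncomp = (\<lambda>i\<in>Obj I. Id1 A (F0 F i)), ncell = (\<lambda>u\<in>Mor I. Id2 A (F1 F u))\<rparr>"

definition ps_comp ::
  "('i, 'j, 'k) two_cat \<Rightarrow> ('o, 'm, 'c) two_cat \<Rightarrow>
   ('i, 'j, 'k, 'o, 'm, 'c) ps_nat \<Rightarrow> ('i, 'j, 'k, 'o, 'm, 'c) ps_nat \<Rightarrow>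
   ('i, 'j, 'k, 'o, 'm, 'c) ps_nat" where
  "ps_comp I A \<nu> \<mu> = \<lparr>nsrc = nsrc \<mu>, ntgt = ntgt \<nu>,
     ncomp = (\<lambda>i\<in>Obj I. Comp A (ncomp \<nu> i) (ncomp \<mu> i)),
     ncell = (\<lambda>u\<in>Mor I. VComp A (wl A (ncomp \<nu> (Cod I u)) (ncell \<mu> u))
                               (wr A (ncell \<nu> u) (ncomp \<mu> (Dom I u))))\<rparr>"

definition Ps ::
  "('i, 'j, 'k) two_cat \<Rightarrow> ('o, 'm, 'c) two_cat \<Rightarrow>
   (('i, 'j, 'k, 'o, 'm, 'c) two_functor, ('i, 'j, 'k, 'o, 'm, 'c) ps_nat,
    ('i, 'j, 'k, 'o, 'm, 'c) modification) two_cat" where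
  "Ps I A =
     \<lparr>Obj = {F. is_two_functor I A F},
      Mor = {\<mu>. is_ps_nat I A \<mu>},
      Dom = nsrc, Cod = ntgt, Id1 = ps_id I A, Comp = ps_comp I A,
      Cell = {\<phi>. is_modification I A \<phi>},
      Src = msrc, Tgt = mtgt,
      Id2 = (\<lambda>\<mu>. \<lparr>msrc = \<mu>, mtgt = \<mu>, mcomp = (\<lambda>i\<in>Obj I. Id2 A (ncomp \<mu> i))\<rparr>),
      VComp = (\<lambda>\<psi> \<phi>. \<lparr>msrc = msrc \<phi>, mtgt = mtgt \<psi>,
                 mcomp = (\<lambda>i\<in>Obj I. VComp A (mcomp \<psi> i) (mcomp \<phi> i))\<rparr>),
      HComp = (\<lambda>\<psi> \<phi>. \<lparr>msrc = ps_comp I A (msrc \<psi>) (msrc \<phi>), mtgt = ps_comp I A (mtgt \<psi>) (mtgt \<phi>),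
                 mcomp = (\<lambda>i\<in>Obj I. HComp A (mcomp \<psi> i) (mcomp \<phi> i))\<rparr>)\<rparr>"


section \<open>Pseudo-cones, pseudo-limits and the strict-slice\<close>

definition \<Delta>0 ::
  "('i, 'j, 'k) two_cat \<Rightarrow> ('o, 'm, 'c) two_cat \<Rightarrow> 'o \<Rightarrow> ('i, 'j, 'k, 'o, 'm, 'c) two_functor" where
  "\<Delta>0 I A x = \<lparr>F0 = (\<lambda>i\<in>Obj I. x), F1 = (\<lambda>u\<in>Mor I. Id1 A x), F2 = (\<lambda>\<alpha>\<in>Cell I. Id2 A (Id1 A x))\<rparr>"

definition \<Delta>1 ::
  "('i, 'j, 'k) two_cat \<Rightarrow> ('o, 'm, 'c) two_cat \<Rightarrow> 'm \<Rightarrow> ('i, 'j, 'k, 'o, 'm, 'c) ps_nat" where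
  "\<Delta>1 I A h = \<lparr>nsrc = \<Delta>0 I A (Dom A h), ntgt = \<Delta>0 I A (Cod A h),
     ncomp = (\<lambda>i\<in>Obj I. h), ncell = (\<lambda>u\<in>Mor I. Id2 A h)\<rparr>"

definition \<Delta>2 ::
  "('i, 'j, 'k) two_cat \<Rightarrow> ('o, 'm, 'c) two_cat \<Rightarrow> 'c \<Rightarrow> ('i, 'j, 'k, 'o, 'm, 'c) modification" where
  "\<Delta>2 I A \<alpha> = \<lparr>msrc = \<Delta>1 I A (Src A \<alpha>), mtgt = \<Delta>1 I A (Tgt A \<alpha>), mcomp = (\<lambda>i\<in>Obj I. \<alpha>)\<rparr>"

definition is_ps_cone ::
  "('i, 'j, 'k) two_cat \<Rightarrow> ('o, 'm, 'c) two_cat \<Rightarrow> ('i, 'j, 'k, 'o, 'm, 'c) two_functor \<Rightarrow>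
   'o \<Rightarrow> ('i, 'j, 'k, 'o, 'm, 'c) ps_nat \<Rightarrow> bool" where
  "is_ps_cone I A F x \<mu> \<longleftrightarrow> x \<in> Obj A \<and> \<mu> \<in> Mor (Ps I A) \<and>
     Dom (Ps I A) \<mu> = \<Delta>0 I A x \<and> Cod (Ps I A) \<mu> = F"

definition is_pseudo_limit ::
  "('i, 'j, 'k) two_cat \<Rightarrow> ('o, 'm, 'c) two_cat \<Rightarrow> ('i, 'j, 'k, 'o, 'm, 'c) two_functor \<Rightarrow>
   'o \<Rightarrow> ('i, 'j, 'k, 'o, 'm, 'c) ps_nat \<Rightarrow> bool" where
  "is_pseudo_limit I A F l \<kappa> \<longleftrightarrow> is_ps_cone I A F l \<kappa> \<and>
     (\<forall>x\<in>Obj A. is_cat_isomorphism (hom_cat A x l) (hom_cat (Ps I A) (\<Delta>0 I A x) F)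
        (\<lambda>h. Comp (Ps I A) \<kappa> (\<Delta>1 I A h))
        (\<lambda>\<alpha>. wl (Ps I A) \<kappa> (\<Delta>2 I A \<alpha>)))"

text \<open>A morphism of the strict-slice is a triple of source, target and underlying morphism of
  \<open>A\<close>; a 2-morphism is a triple of source, target and underlying 2-morphism of \<open>A\<close>.\<close>

type_synonym ('i, 'j, 'k, 'o, 'm, 'c) slice_ob =
  "'o \<times> ('i, 'j, 'k, 'o, 'm, 'c) ps_nat"
type_synonym ('i, 'j, 'k, 'o, 'm, 'c) slice_mor =
  "('i, 'j, 'k, 'o, 'm, 'c) slice_ob \<times> ('i, 'j, 'k, 'o, 'm, 'c) slice_ob \<times> 'm"
type_synonym ('i, 'j, 'k, 'o, 'm, 'c) slice_cell =
  "('i, 'j, 'k, 'o, 'm, 'c) slice_mor \<times> ('i, 'j, 'k, 'o, 'm, 'c) slice_mor \<times> 'c"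

definition slice_mors ::
  "('i, 'j, 'k) two_cat \<Rightarrow> ('o, 'm, 'c) two_cat \<Rightarrow> ('i, 'j, 'k, 'o, 'm, 'c) two_functor \<Rightarrow>
   ('i, 'j, 'k, 'o, 'm, 'c) slice_mor set" where
  "slice_mors I A F = {((x, \<mu>), (y, \<nu>), f) | x \<mu> y \<nu> f.
     is_ps_cone I A F x \<mu> \<and> is_ps_cone I A F y \<nu> \<and>
     f \<in> Mor A \<and> Dom A f = x \<and> Cod A f = y \<and> Comp (Ps I A) \<nu> (\<Delta>1 I A f) = \<mu>}"

definition slice_cells ::
  "('i, 'j, 'k) two_cat \<Rightarrow> ('o, 'm, 'c) two_cat \<Rightarrow> ('i, 'j, 'k, 'o, 'm, 'c) two_functor \<Rightarrow>
   ('i, 'j, 'k, 'o, 'm, 'c) slice_cell set" where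
  "slice_cells I A F = {(((x, \<mu>), (y, \<nu>), f), ((x, \<mu>), (y, \<nu>), g), \<alpha>) | x \<mu> y \<nu> f g \<alpha>.
     ((x, \<mu>), (y, \<nu>), f) \<in> slice_mors I A F \<and> ((x, \<mu>), (y, \<nu>), g) \<in> slice_mors I A F \<and>
     \<alpha> \<in> Cell A \<and> Src A \<alpha> = f \<and> Tgt A \<alpha> = g \<and>
     wl (Ps I A) \<nu> (\<Delta>2 I A \<alpha>) = Id2 (Ps I A) \<mu>}"

definition strict_slice ::
  "('i, 'j, 'k) two_cat \<Rightarrow> ('o, 'm, 'c) two_cat \<Rightarrow> ('i, 'j, 'k, 'o, 'm, 'c) two_functor \<Rightarrow>
   (('i, 'j, 'k, 'o, 'm, 'c) slice_ob, ('i, 'j, 'k, 'o, 'm, 'c) slice_mor,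
    ('i, 'j, 'k, 'o, 'm, 'c) slice_cell) two_cat" where
  "strict_slice I A F = (let
       comp1 = (\<lambda>(y, z, g) (x, y', f). (x, z, Comp A g f))
     in
     \<lparr>Obj = {(x, \<mu>). is_ps_cone I A F x \<mu>},
      Mor = slice_mors I A F,
      Dom = (\<lambda>(x, y, f). x), Cod = (\<lambda>(x, y, f). y),
      Id1 = (\<lambda>(x, \<mu>). ((x, \<mu>), (x, \<mu>), Id1 A x)),
      Comp = comp1,
      Cell = slice_cells I A F,
      Src = (\<lambda>(f, g, \<alpha>). f), Tgt = (\<lambda>(f, g, \<alpha>). g),
      Id2 = (\<lambda>(x, y, f). ((x, y, f), (x, y, f), Id2 A f)),
      VComp = (\<lambda>(g, h, \<beta>) (f, g', \<alpha>). (f, h, VComp A \<beta> \<alpha>)),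
      HComp = (\<lambda>(h, k, \<beta>) (f, g, \<alpha>). (comp1 h f, comp1 k g, HComp A \<beta> \<alpha>))\<rparr>)"


section \<open>2-categories presented by generators and relations\<close>

text \<open>The objects are the elements of \<open>'o\<close>, the generating morphisms those of \<open>'g\<close> and the
  generating 2-morphisms those of \<open>'h\<close>. Morphisms and 2-morphisms of the presented 2-category
  are equivalence classes of well-formed formal composites, for the smallest congruence that
  contains the listed relations and the axioms of a 2-category.\<close>

datatype ('o, 'g) tm1 =
    TId 'o
  | TGen 'g
  | TComp "('o, 'g) tm1" "('o, 'g) tm1"

datatype ('o, 'g, 'h) tm2 =
    CId "('o, 'g) tm1"
  | CGen 'h
  | CV "('o, 'g, 'h) tm2" "('o, 'g, 'h) tm2"
  | CH "('o, 'g, 'h) tm2" "('o, 'g, 'h) tm2"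

record ('o, 'g, 'h) presentation =
  gdom :: "'g \<Rightarrow> 'o"
  gcod :: "'g \<Rightarrow> 'o"
  gsrc :: "'h \<Rightarrow> ('o, 'g) tm1"
  gtgt :: "'h \<Rightarrow> ('o, 'g) tm1"
  rels1 :: "(('o, 'g) tm1 \<times> ('o, 'g) tm1) set"
  rels2 :: "(('o, 'g, 'h) tm2 \<times> ('o, 'g, 'h) tm2) set"

context
  fixes P :: "('o, 'g, 'h) presentation"
begin

primrec tdom :: "('o, 'g) tm1 \<Rightarrow> 'o" where
  "tdom (TId x) = x"
| "tdom (TGen g) = gdom P g"
| "tdom (TComp t s) = tdom s"

primrec tcod :: "('o, 'g) tm1 \<Rightarrow> 'o" where
  "tcod (TId x) = x"
| "tcod (TGen g) = gcod P g"
| "tcod (TComp t s) = tcod t"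

primrec wf1 :: "('o, 'g) tm1 \<Rightarrow> bool" where
  "wf1 (TId x) = True"
| "wf1 (TGen g) = True"
| "wf1 (TComp t s) = (wf1 t \<and> wf1 s \<and> tdom t = tcod s)"

inductive eq1 :: "('o, 'g) tm1 \<Rightarrow> ('o, 'g) tm1 \<Rightarrow> bool" where
  eq1_rel: "(t, s) \<in> rels1 P \<Longrightarrow> eq1 t s"
| eq1_refl: "wf1 t \<Longrightarrow> eq1 t t"
| eq1_sym: "eq1 t s \<Longrightarrow> eq1 s t"
| eq1_trans: "eq1 t s \<Longrightarrow> eq1 s r \<Longrightarrow> eq1 t r"
| eq1_comp: "eq1 t t' \<Longrightarrow> eq1 s s' \<Longrightarrow> tdom t = tcod s \<Longrightarrow> eq1 (TComp t s) (TComp t' s')"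
| eq1_unit_right: "wf1 t \<Longrightarrow> eq1 (TComp t (TId (tdom t))) t"
| eq1_unit_left: "wf1 t \<Longrightarrow> eq1 (TComp (TId (tcod t)) t) t"
| eq1_assoc: "wf1 (TComp (TComp t s) r) \<Longrightarrow> eq1 (TComp (TComp t s) r) (TComp t (TComp s r))"

primrec csrc :: "('o, 'g, 'h) tm2 \<Rightarrow> ('o, 'g) tm1" where
  "csrc (CId t) = t"
| "csrc (CGen h) = gsrc P h"
| "csrc (CV b a) = csrc a"
| "csrc (CH b a) = TComp (csrc b) (csrc a)"

primrec ctgt :: "('o, 'g, 'h) tm2 \<Rightarrow> ('o, 'g) tm1" where
  "ctgt (CId t) = t"
| "ctgt (CGen h) = gtgt P h"
| "ctgt (CV b a) = ctgt b"
| "ctgt (CH b a) = TComp (ctgt b) (ctgt a)"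

primrec wf2 :: "('o, 'g, 'h) tm2 \<Rightarrow> bool" where
  "wf2 (CId t) = wf1 t"
| "wf2 (CGen h) = True"
| "wf2 (CV b a) = (wf2 b \<and> wf2 a \<and> eq1 (csrc b) (ctgt a))"
| "wf2 (CH b a) = (wf2 b \<and> wf2 a \<and> tdom (csrc b) = tcod (csrc a))"

inductive eq2 :: "('o, 'g, 'h) tm2 \<Rightarrow> ('o, 'g, 'h) tm2 \<Rightarrow> bool" where
  eq2_rel: "(a, b) \<in> rels2 P \<Longrightarrow> eq2 a b"
| eq2_refl: "wf2 a \<Longrightarrow> eq2 a a"
| eq2_sym: "eq2 a b \<Longrightarrow> eq2 b a"
| eq2_trans: "eq2 a b \<Longrightarrow> eq2 b c \<Longrightarrow> eq2 a c"
| eq2_id: "eq1 t s \<Longrightarrow> eq2 (CId t) (CId s)"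
| eq2_vcomp: "eq2 b b' \<Longrightarrow> eq2 a a' \<Longrightarrow> eq1 (csrc b) (ctgt a) \<Longrightarrow> eq2 (CV b a) (CV b' a')"
| eq2_hcomp: "eq2 b b' \<Longrightarrow> eq2 a a' \<Longrightarrow> tdom (csrc b) = tcod (csrc a) \<Longrightarrow> eq2 (CH b a) (CH b' a')"
| eq2_v_unit_right: "wf2 a \<Longrightarrow> eq2 (CV a (CId (csrc a))) a"
| eq2_v_unit_left: "wf2 a \<Longrightarrow> eq2 (CV (CId (ctgt a)) a) a"
| eq2_v_assoc: "wf2 (CV (CV c b) a) \<Longrightarrow> eq2 (CV (CV c b) a) (CV c (CV b a))"
| eq2_h_unit_right: "wf2 a \<Longrightarrow> eq2 (CH a (CId (TId (tdom (csrc a))))) a"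
| eq2_h_unit_left: "wf2 a \<Longrightarrow> eq2 (CH (CId (TId (tcod (csrc a)))) a) a"
| eq2_h_assoc: "wf2 (CH (CH c b) a) \<Longrightarrow> eq2 (CH (CH c b) a) (CH c (CH b a))"
| eq2_h_id: "wf1 (TComp t s) \<Longrightarrow> eq2 (CH (CId t) (CId s)) (CId (TComp t s))"
| eq2_interchange: "wf2 (CH (CV b' b) (CV a' a)) \<Longrightarrow>
    eq2 (CH (CV b' b) (CV a' a)) (CV (CH b' a') (CH b a))"

definition class1 :: "('o, 'g) tm1 \<Rightarrow> ('o, 'g) tm1 set" where
  "class1 t = {s. eq1 t s}"

definition class2 :: "('o, 'g, 'h) tm2 \<Rightarrow> ('o, 'g, 'h) tm2 set" where
  "class2 a = {b. eq2 a b}"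

definition presented :: "('o, ('o, 'g) tm1 set, ('o, 'g, 'h) tm2 set) two_cat" where
  "presented =
     \<lparr>Obj = UNIV,
      Mor = {class1 t | t. wf1 t},
      Dom = (\<lambda>f. the_elem (tdom ` f)),
      Cod = (\<lambda>f. the_elem (tcod ` f)),
      Id1 = (\<lambda>x. class1 (TId x)),
      Comp = (\<lambda>g f. \<Union>t\<in>g. \<Union>s\<in>f. class1 (TComp t s)),
      Cell = {class2 a | a. wf2 a},
      Src = (\<lambda>\<alpha>. \<Union>a\<in>\<alpha>. class1 (csrc a)),
      Tgt = (\<lambda>\<alpha>. \<Union>a\<in>\<alpha>. class1 (ctgt a)),
      Id2 = (\<lambda>f. \<Union>t\<in>f. class2 (CId t)),
      VComp = (\<lambda>\<beta> \<alpha>. \<Union>b\<in>\<beta>. \<Union>a\<in>\<alpha>. class2 (CV b a)),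
      HComp = (\<lambda>\<beta> \<alpha>. \<Union>b\<in>\<beta>. \<Union>a\<in>\<alpha>. class2 (CH b a))\<rparr>"

text \<open>The data form a presentation if the sources and targets of the generating 2-morphisms and
  both sides of every relation are parallel; for 2-morphisms, parallel modulo the relations
  between morphisms.\<close>

definition wf_presentation :: bool where
  "wf_presentation \<longleftrightarrow>
     (\<forall>h. wf1 (gsrc P h) \<and> wf1 (gtgt P h) \<and>
        tdom (gsrc P h) = tdom (gtgt P h) \<and> tcod (gsrc P h) = tcod (gtgt P h)) \<and>
     (\<forall>(t, s)\<in>rels1 P. wf1 t \<and> wf1 s \<and> tdom t = tdom s \<and> tcod t = tcod s) \<and>
     (\<forall>(a, b)\<in>rels2 P. wf2 a \<and> wf2 b \<and> eq1 (csrc a) (csrc b) \<and> eq1 (ctgt a) (ctgt b))"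

end


section \<open>The 2-category, the diagram and the cone of the example\<close>

datatype cospan_ob = PtB | PtA | PtC
datatype cospan_ar = IdAt cospan_ob | ArB | ArC

primrec cospan_src :: "cospan_ar \<Rightarrow> cospan_ob" where
  "cospan_src (IdAt i) = i"
| "cospan_src ArB = PtB"
| "cospan_src ArC = PtC"

primrec cospan_tgt :: "cospan_ar \<Rightarrow> cospan_ob" where
  "cospan_tgt (IdAt i) = i"
| "cospan_tgt ArB = PtA"
| "cospan_tgt ArC = PtA"

text \<open>Of two composable arrows of the shape at least one is an identity.\<close>

definition cospan_cat :: "(cospan_ob, cospan_ar) category" where
  "cospan_cat =
     \<lparr>Ob = UNIV, Ar = UNIV, Sr = cospan_src, Tr = cospan_tgt, Idt = IdAt,
      Cmp = (\<lambda>v u. case v of IdAt i \<Rightarrow> u | _ \<Rightarrow> v)\<rparr>"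

definition cospan :: "(cospan_ob, cospan_ar, cospan_ar) two_cat" where
  "cospan = locally_discrete cospan_cat"

datatype ob_gen = GX | GL | GA | GB | GC
datatype mor_gen = Gf | Gg | Glambda0 | Glambda1 | Gb | Gc
datatype cell_gen = Ggamma0 | Ggamma1

type_synonym ex_mor = "(ob_gen, mor_gen) tm1 set"
type_synonym ex_cell = "(ob_gen, mor_gen, cell_gen) tm2 set"

definition ex_presentation :: "(ob_gen, mor_gen, cell_gen) presentation" where
  "ex_presentation =
     \<lparr>gdom = (\<lambda>g. case g of Gf \<Rightarrow> GX | Gg \<Rightarrow> GX | Glambda0 \<Rightarrow> GL | Glambda1 \<Rightarrow> GL | Gb \<Rightarrow> GB | Gc \<Rightarrow> GC),
      gcod = (\<lambda>g. case g of Gf \<Rightarrow> GL | Gg \<Rightarrow> GL | Glambda0 \<Rightarrow> GB | Glambda1 \<Rightarrow> GC | Gb \<Rightarrow> GA | Gc \<Rightarrow> GA),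
      gsrc = (\<lambda>h. case h of Ggamma0 \<Rightarrow> TComp (TGen Glambda0) (TGen Gf)
                          | Ggamma1 \<Rightarrow> TComp (TGen Glambda1) (TGen Gf)),
      gtgt = (\<lambda>h. case h of Ggamma0 \<Rightarrow> TComp (TGen Glambda0) (TGen Gg)
                          | Ggamma1 \<Rightarrow> TComp (TGen Glambda1) (TGen Gg)),
      rels1 = {(TComp (TGen Gb) (TGen Glambda0), TComp (TGen Gc) (TGen Glambda1))},
      rels2 = {(CH (CId (TGen Gb)) (CGen Ggamma0), CH (CId (TGen Gc)) (CGen Ggamma1))}\<rparr>"

definition ex_A :: "(ob_gen, ex_mor, ex_cell) two_cat" where
  "ex_A = presented ex_presentation"

definition ex_gen :: "mor_gen \<Rightarrow> ex_mor" where
  "ex_gen g = class1 ex_presentation (TGen g)"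

definition ex_F :: "(cospan_ob, cospan_ar, cospan_ar, ob_gen, ex_mor, ex_cell) two_functor" where
  "ex_F = (let
       D0 = (\<lambda>i. case i of PtB \<Rightarrow> GB | PtA \<Rightarrow> GA | PtC \<Rightarrow> GC);
       D1 = (\<lambda>u. case u of IdAt i \<Rightarrow> Id1 ex_A (D0 i) | ArB \<Rightarrow> ex_gen Gb | ArC \<Rightarrow> ex_gen Gc)
     in \<lparr>F0 = D0, F1 = D1, F2 = (\<lambda>u. Id2 ex_A (D1 u))\<rparr>)"

definition ex_lambda :: "(cospan_ob, cospan_ar, cospan_ar, ob_gen, ex_mor, ex_cell) ps_nat" where
  "ex_lambda = (let
       l = (\<lambda>i. case i of PtB \<Rightarrow> ex_gen Glambda0
                        | PtA \<Rightarrow> Comp ex_A (ex_gen Gb) (ex_gen Glambda0)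
                        | PtC \<Rightarrow> ex_gen Glambda1)
     in \<lparr>nsrc = \<Delta>0 cospan ex_A GL, ntgt = ex_F,
         ncomp = l, ncell = (\<lambda>u. Id2 ex_A (l (cospan_tgt u)))\<rparr>)"


section \<open>The presented structures are 2-categories\<close>

lemma eq1_wf:
  assumes "wf_presentation P" and "eq1 P t s"
  shows "wf1 P t \<and> wf1 P s \<and> tdom P t = tdom P s \<and> tcod P t = tcod P s"
  using assms(2) by induction (use assms(1) in \<open>auto simp: wf_presentation_def\<close>)

lemma wf2_parallel:
  assumes P: "wf_presentation P" and "wf2 P a"
  shows "wf1 P (csrc P a) \<and> wf1 P (ctgt P a) \<and>
    tdom P (csrc P a) = tdom P (ctgt P a) \<and> tcod P (csrc P a) = tcod P (ctgt P a)"
  using assms(2)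
proof (induction a)
  case (CGen h) then show ?case using P by (auto simp: wf_presentation_def)
qed (auto dest!: eq1_wf[OF P])

lemma wf2_csrc:
  assumes "wf_presentation P" and "wf2 P a"
  shows "wf1 P (csrc P a)" "wf1 P (ctgt P a)"
    "tdom P (ctgt P a) = tdom P (csrc P a)" "tcod P (ctgt P a) = tcod P (csrc P a)"
  using wf2_parallel[OF assms] by simp_all

lemma eq2_wf:
  assumes P: "wf_presentation P" and "eq2 P a b"
  shows "wf2 P a \<and> wf2 P b \<and> eq1 P (csrc P a) (csrc P b) \<and> eq1 P (ctgt P a) (ctgt P b)"
  using assms(2)
proof induction
  case (eq2_h_unit_right a)
  then show ?case using eq1_unit_right[of P "ctgt P a"]
    by (simp add: wf2_csrc[OF P] eq1_unit_right)
next
  case (eq2_h_unit_left a)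
  then show ?case using eq1_unit_left[of P "ctgt P a"]
    by (simp add: wf2_csrc[OF P] eq1_unit_left)
next
  case (eq2_rel a b) then show ?case using P by (auto simp: wf_presentation_def)
next
  case (eq2_sym a b) then show ?case by (simp add: eq1_sym)
next
  case (eq2_trans a b c) then show ?case by (meson eq1_trans)
next
  case (eq2_id t s)
  then show ?case by (auto dest: eq1_wf[OF P])
next
  case (eq2_vcomp b b' a a')
  then have "eq1 P (csrc P b') (ctgt P a')" by (meson eq1_trans eq1_sym)
  with eq2_vcomp show ?case by simp
next
  case (eq2_hcomp b b' a a')
  then have "tdom P (csrc P b') = tcod P (csrc P a')" "tdom P (ctgt P b) = tcod P (ctgt P a)"
    by (metis eq1_wf[OF P], metis wf2_parallel[OF P])
  with eq2_hcomp show ?case by (simp add: eq1_comp)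
next
  case (eq2_interchange b' b a' a)
  then have "tdom P (csrc P b') = tcod P (csrc P a')" "tdom P (ctgt P b) = tcod P (ctgt P a)"
    "tdom P (ctgt P b') = tcod P (ctgt P a')"
    by (auto dest!: wf2_parallel[OF P] eq1_wf[OF P])
  with eq2_interchange show ?case
    by (simp add: eq1_comp eq1_refl wf2_csrc[OF P])
qed (simp_all add: wf2_csrc[OF P] eq1_refl eq1_unit_left eq1_unit_right eq1_assoc)

context
  fixes P :: "('o, 'g, 'h) presentation"
  assumes P: "wf_presentation P"
begin

lemma class1_eq: "eq1 P t s \<Longrightarrow> class1 P t = class1 P s"
  by (auto simp: class1_def intro: eq1_sym eq1_trans)

lemma class2_eq: "eq2 P a b \<Longrightarrow> class2 P a = class2 P b"
  by (auto simp: class2_def intro: eq2_sym eq2_trans)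

lemma class1_UN:
  assumes "wf1 P t" "\<And>s. eq1 P t s \<Longrightarrow> f s = f t"
  shows "(\<Union>s\<in>class1 P t. f s) = f t"
  using assms by (auto simp: class1_def intro: eq1_refl)

lemma class2_UN:
  assumes "wf2 P t" "\<And>s. eq2 P t s \<Longrightarrow> f s = f t"
  shows "(\<Union>s\<in>class2 P t. f s) = f t"
  using assms by (auto simp: class2_def intro: eq2_refl)

lemma class1_elem:
  assumes "wf1 P t" "\<And>s. eq1 P t s \<Longrightarrow> f s = f t"
  shows "the_elem (f ` class1 P t) = f t"
proof -
  have "f ` class1 P t = {f t}"
    using assms by (auto simp: class1_def intro: eq1_refl)
  then show ?thesis by simp
qed

lemma presented_simps:
  "Obj (presented P) = UNIV"
  "Mor (presented P) = {class1 P t | t. wf1 P t}"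
  "Cell (presented P) = {class2 P a | a. wf2 P a}"
  "Id1 (presented P) x = class1 P (TId x)"
  "wf1 P t \<Longrightarrow> Dom (presented P) (class1 P t) = tdom P t"
  "wf1 P t \<Longrightarrow> Cod (presented P) (class1 P t) = tcod P t"
  "wf1 P (TComp t s) \<Longrightarrow> Comp (presented P) (class1 P t) (class1 P s) = class1 P (TComp t s)"
  "wf2 P a \<Longrightarrow> Src (presented P) (class2 P a) = class1 P (csrc P a)"
  "wf2 P a \<Longrightarrow> Tgt (presented P) (class2 P a) = class1 P (ctgt P a)"
  "wf1 P t \<Longrightarrow> Id2 (presented P) (class1 P t) = class2 P (CId t)"
  "wf2 P (CV b a) \<Longrightarrow> VComp (presented P) (class2 P b) (class2 P a) = class2 P (CV b a)"
  "wf2 P (CH b a) \<Longrightarrow> HComp (presented P) (class2 P b) (class2 P a) = class2 P (CH b a)"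
proof -
  note w = eq1_wf[OF P] eq2_wf[OF P]
  show "wf1 P t \<Longrightarrow> Dom (presented P) (class1 P t) = tdom P t"
    by (auto simp: presented_def intro!: class1_elem dest: w)
  show "wf1 P t \<Longrightarrow> Cod (presented P) (class1 P t) = tcod P t"
    by (auto simp: presented_def intro!: class1_elem dest: w)
  show "wf2 P a \<Longrightarrow> Src (presented P) (class2 P a) = class1 P (csrc P a)"
    unfolding presented_def by simp (rule class2_UN, auto intro!: class1_eq dest: w eq1_sym)
  show "wf2 P a \<Longrightarrow> Tgt (presented P) (class2 P a) = class1 P (ctgt P a)"
    unfolding presented_def by simp (rule class2_UN, auto intro!: class1_eq dest: w eq1_sym)
  show "wf1 P t \<Longrightarrow> Id2 (presented P) (class1 P t) = class2 P (CId t)"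
    unfolding presented_def by simp (rule class1_UN, auto intro!: class2_eq eq2_id dest: eq1_sym)
  show "Comp (presented P) (class1 P t) (class1 P s) = class1 P (TComp t s)"
    if *: "wf1 P (TComp t s)"
  proof -
    have "class1 P (TComp t' s') = class1 P (TComp t s)"
      if "eq1 P t t'" "eq1 P s s'" for t' s'
      by (intro class1_eq eq1_sym[OF eq1_comp] that) (use * in auto)
    moreover have "t \<in> class1 P t" "s \<in> class1 P s"
      using * by (auto simp: class1_def intro: eq1_refl)
    ultimately have "(\<Union>x\<in>class1 P t. \<Union>y\<in>class1 P s. class1 P (TComp x y)) = class1 P (TComp t s)"
      unfolding class1_def[of P t] class1_def[of P s] by blast
    then show ?thesis unfolding presented_def by simp
  qed
  show "VComp (presented P) (class2 P b) (class2 P a) = class2 P (CV b a)"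
    if *: "wf2 P (CV b a)"
  proof -
    have "class2 P (CV b' a') = class2 P (CV b a)"
      if "eq2 P b b'" "eq2 P a a'" for b' a'
      by (intro class2_eq eq2_sym[OF eq2_vcomp] that) (use * in auto)
    moreover have "b \<in> class2 P b" "a \<in> class2 P a"
      using * by (auto simp: class2_def intro: eq2_refl)
    ultimately have "(\<Union>x\<in>class2 P b. \<Union>y\<in>class2 P a. class2 P (CV x y)) = class2 P (CV b a)"
      unfolding class2_def[of P b] class2_def[of P a] by blast
    then show ?thesis unfolding presented_def by simp
  qed
  show "HComp (presented P) (class2 P b) (class2 P a) = class2 P (CH b a)"
    if *: "wf2 P (CH b a)"
  proof -
    have "class2 P (CH b' a') = class2 P (CH b a)"
      if "eq2 P b b'" "eq2 P a a'" for b' a'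
      by (intro class2_eq eq2_sym[OF eq2_hcomp] that) (use * in auto)
    moreover have "b \<in> class2 P b" "a \<in> class2 P a"
      using * by (auto simp: class2_def intro: eq2_refl)
    ultimately have "(\<Union>x\<in>class2 P b. \<Union>y\<in>class2 P a. class2 P (CH x y)) = class2 P (CH b a)"
      unfolding class2_def[of P b] class2_def[of P a] by blast
    then show ?thesis unfolding presented_def by simp
  qed
qed (auto simp: presented_def)

lemma class1_eq_iff: "wf1 P t \<Longrightarrow> class1 P s = class1 P t \<longleftrightarrow> eq1 P s t"
  using class1_eq eq1_refl unfolding class1_def by blast

lemma class2_eq_iff: "wf2 P t \<Longrightarrow> class2 P s = class2 P t \<longleftrightarrow> eq2 P s t"
  using class2_eq eq2_refl unfolding class2_def by blast


lemma presented_MorE: "f \<in> Mor (presented P) \<Longrightarrow> (\<And>t. wf1 P t \<Longrightarrow> f = class1 P t \<Longrightarrow> R) \<Longrightarrow> R"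
  by (auto simp: presented_simps)
lemma presented_CellE: "f \<in> Cell (presented P) \<Longrightarrow> (\<And>t. wf2 P t \<Longrightarrow> f = class2 P t \<Longrightarrow> R) \<Longrightarrow> R"
  by (auto simp: presented_simps)
lemma presented_MorI: "wf1 P t \<Longrightarrow> class1 P t \<in> Mor (presented P)"
  by (auto simp: presented_simps)
lemma presented_CellI: "wf2 P t \<Longrightarrow> class2 P t \<in> Cell (presented P)"
  by (auto simp: presented_simps)


lemma presented_interchange:
  assumes eqs: "eq1 P (csrc P a') (ctgt P a)" "eq1 P (csrc P b') (ctgt P b)"
    and wf: "wf2 P a" "wf2 P a'" "wf2 P b" "wf2 P b'"
    and d: "tdom P (csrc P b) = tcod P (csrc P a)"
  shows "class2 P (CH (CV b' b) (CV a' a)) =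
    VComp (presented P) (HComp (presented P) (class2 P b') (class2 P a')) (class2 P (CH b a))"
proof -
  have d': "tdom P (csrc P b') = tcod P (csrc P a')"
    using d eqs[THEN eq1_wf[OF P]] wf by (simp add: wf2_csrc[OF P])
  have "eq1 P (TComp (csrc P b') (csrc P a')) (TComp (ctgt P b) (ctgt P a))"
    by (intro eq1_comp eqs d')
  then have "VComp (presented P) (HComp (presented P) (class2 P b') (class2 P a')) (class2 P (CH b a))
      = class2 P (CV (CH b' a') (CH b a))"
    using wf d d' by (simp add: presented_simps)
  then show ?thesis
    using eqs wf d by (simp add: class2_eq eq2_interchange)
qed

lemma two_category_presented: "two_category (presented P)"
  by (unfold_locales; (elim presented_MorE presented_CellE)?)
    (simp_all add: presented_simps(1,4-) presented_MorI presented_CellI wf2_csrc[OF P] class1_eq_iff class2_eq_iff eq1_refl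
      eq1_unit_left eq1_unit_right eq1_assoc eq2_v_unit_right eq2_v_unit_left eq2_v_assoc
      eq2_h_unit_right eq2_h_unit_left eq2_h_assoc eq2_h_id presented_interchange)

end

lemma wf_ex_presentation: "wf_presentation ex_presentation"
proof -
  let ?P = ex_presentation
  have rel: "eq1 ?P (TComp (TGen Gb) (TGen Glambda0)) (TComp (TGen Gc) (TGen Glambda1))"
    by (rule eq1_rel) (simp add: ex_presentation_def)
  have "eq1 ?P (TComp (TGen Gb) (TComp (TGen Glambda0) (TGen h)))
               (TComp (TGen Gc) (TComp (TGen Glambda1) (TGen h)))"
    if "h = Gf \<or> h = Gg" for h
  proof -
    have "eq1 ?P (TComp (TComp (TGen Gb) (TGen Glambda0)) (TGen h))
                 (TComp (TComp (TGen Gc) (TGen Glambda1)) (TGen h))"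
      by (rule eq1_comp[OF rel eq1_refl]) (use that in \<open>auto simp: ex_presentation_def\<close>)
    moreover have "eq1 ?P (TComp (TComp (TGen Gb) (TGen Glambda0)) (TGen h))
        (TComp (TGen Gb) (TComp (TGen Glambda0) (TGen h)))"
      "eq1 ?P (TComp (TComp (TGen Gc) (TGen Glambda1)) (TGen h))
        (TComp (TGen Gc) (TComp (TGen Glambda1) (TGen h)))"
      by (rule eq1_assoc; use that in \<open>auto simp: ex_presentation_def\<close>)+
    ultimately show ?thesis by (meson eq1_sym eq1_trans)
  qed
  from this[of Gf] this[of Gg] show ?thesis
    by (auto simp: wf_presentation_def ex_presentation_def split: cell_gen.split)
qed

lemma two_category_ex_A: "two_category ex_A"
  unfolding ex_A_def by (rule two_category_presented[OF wf_ex_presentation])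

lemma ex_square: "Comp ex_A (ex_gen Gb) (ex_gen Glambda0) = Comp ex_A (ex_gen Gc) (ex_gen Glambda1)"
proof -
  have "eq1 ex_presentation (TComp (TGen Gb) (TGen Glambda0)) (TComp (TGen Gc) (TGen Glambda1))"
    by (rule eq1_rel) (simp add: ex_presentation_def)
  moreover from eq1_wf[OF wf_ex_presentation this]
  have "wf1 ex_presentation (TComp (TGen Gb) (TGen Glambda0))"
    "wf1 ex_presentation (TComp (TGen Gc) (TGen Glambda1))" by blast+
  ultimately show ?thesis
    unfolding ex_A_def ex_gen_def
    by (simp only: presented_simps(7)[OF wf_ex_presentation] class1_eq[OF wf_ex_presentation])
qed

lemma cospan_simps:
  "Obj cospan = UNIV" "Mor cospan = UNIV" "Cell cospan = UNIV"
  "Dom cospan = cospan_src" "Cod cospan = cospan_tgt" "Id1 cospan = IdAt"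
  "Src cospan = id" "Tgt cospan = id" "Id2 cospan = id" "VComp cospan \<beta> \<alpha> = \<alpha>"
  "HComp cospan = Comp cospan"
  "Comp cospan (IdAt i) u = u" "Comp cospan ArB u = ArB" "Comp cospan ArC u = ArC"
  by (simp_all add: cospan_def locally_discrete_def cospan_cat_def)

lemma two_category_cospan: "two_category cospan"
proof -
  have 1: "Comp cospan u (IdAt (cospan_src u)) = u" for u
    by (cases u) (simp_all add: cospan_simps)
  have 2: "cospan_src (Comp cospan v u) = cospan_src u \<and> cospan_tgt (Comp cospan v u) = cospan_tgt v"
    if "cospan_src v = cospan_tgt u" for u v
    using that by (cases u; cases v) (simp_all add: cospan_simps)
  have 3: "Comp cospan (Comp cospan w v) u = Comp cospan w (Comp cospan v u)" for u v w
    by (cases w) (simp_all add: cospan_simps)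
  show ?thesis
    by unfold_locales (simp_all add: cospan_simps(1-12) 1 2 3)
qed

end

theory Submission
  imports Defs
begin

text \<open>A morphism of the presented 2-category is determined by its domain, its codomain and
  whether it passes through \<open>g\<close>; the only 2-morphisms besides identities are \<open>\<gamma>\<^sub>0\<close>, \<open>\<gamma>\<^sub>1\<close> and
  \<open>b * \<gamma>\<^sub>0 = c * \<gamma>\<^sub>1\<close>. These three lead from a morphism that avoids \<open>g\<close> to one that passes through
  it, so invertible 2-morphisms are identities and every pseudo-cone is a commuting pair of legs,
  which factors uniquely through \<open>\<lambda>\<close>. None of the three ends in \<open>L\<close>, so no 2-morphism \<open>f \<Rightarrow> g\<close>
  induces the modification \<open>(\<gamma>\<^sub>0, b * \<gamma>\<^sub>0, \<gamma>\<^sub>1)\<close> from \<open>\<lambda>\<Delta>f\<close> to \<open>\<lambda>\<Delta>g\<close>. That these 2-morphisms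
  are not identities follows from their endpoints, so no model of the presentation is needed to
  separate 2-morphisms.\<close>

section \<open>Morphisms\<close>

primrec uses_g :: "(ob_gen, mor_gen) tm1 \<Rightarrow> bool" where
  "uses_g (TId x) = False"
| "uses_g (TGen h) = (h = Gg)"
| "uses_g (TComp t s) = (uses_g t \<or> uses_g s)"

text \<open>Neither side of the relation \<open>b lambda0 = c lambda1\<close> contains
  \<open>g\<close>, and the unit and associativity laws keep the generators that occur. So
  occurrence of \<open>g\<close> is constant on congruence classes.\<close>

lemma eq1_uses_g: "eq1 ex_presentation t s \<Longrightarrow> uses_g t = uses_g s"
  by (induction rule: eq1.induct) (auto simp: ex_presentation_def)

definition normal_forms :: "(ob_gen, mor_gen) tm1 set" where
  "normal_forms = range TId \<union> range TGen \<union>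
     {TComp (TGen l) (TGen h) | l h. l \<in> {Glambda0, Glambda1} \<and> h \<in> {Gf, Gg}} \<union>
     {TComp (TGen Gb) (TGen Glambda0)} \<union>
     {TComp (TGen Gb) (TComp (TGen Glambda0) (TGen h)) | h. h \<in> {Gf, Gg}}"

lemma eq1_square:
  "eq1 ex_presentation (TComp (TGen Gc) (TGen Glambda1)) (TComp (TGen Gb) (TGen Glambda0))"
  by (rule eq1_sym, rule eq1_rel) (simp add: ex_presentation_def)

lemma eq1_square_comp:
  assumes "h = Gf \<or> h = Gg"
  shows "eq1 ex_presentation (TComp (TGen Gc) (TComp (TGen Glambda1) (TGen h)))
    (TComp (TGen Gb) (TComp (TGen Glambda0) (TGen h)))"
proof -
  have "eq1 ex_presentation (TComp (TComp (TGen Gc) (TGen Glambda1)) (TGen h))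
    (TComp (TComp (TGen Gb) (TGen Glambda0)) (TGen h))"
    by (rule eq1_comp[OF eq1_square eq1_refl]) (use assms in \<open>auto simp: ex_presentation_def\<close>)
  moreover have "eq1 ex_presentation (TComp (TComp (TGen l') (TGen l)) (TGen h))
      (TComp (TGen l') (TComp (TGen l) (TGen h)))"
    if "(l', l) \<in> {(Gb, Glambda0), (Gc, Glambda1)}" for l l'
    by (rule eq1_assoc) (use that assms in \<open>auto simp: ex_presentation_def\<close>)
  ultimately show ?thesis by (meson eq1_sym eq1_trans insertCI)
qed

text \<open>Prefixing a generator to a normal form leaves the list in two situations only: the
  normal form is an identity, which the unit law removes, or the generator is \<open>Gc\<close>,
  where the square relation applies.\<close>

lemma generator_comp_normal_form:
  assumes "n \<in> normal_forms" "gdom ex_presentation h = tcod ex_presentation n"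
  shows "\<exists>k\<in>normal_forms. eq1 ex_presentation (TComp (TGen h) n) k"
proof (cases "\<exists>x. n = TId x")
  case True
  then have "eq1 ex_presentation (TComp (TGen h) n) (TGen h)"
    using eq1_unit_right[of ex_presentation "TGen h"] assms(2) by auto
  then show ?thesis by (auto simp: normal_forms_def)
next
  case False
  show ?thesis
  proof (cases "h = Gc")
    case True
    then have "n = TGen Glambda1 \<or> (\<exists>h. (h = Gf \<or> h = Gg) \<and> n = TComp (TGen Glambda1) (TGen h))"
      using assms False
      by (auto simp: normal_forms_def ex_presentation_def split: mor_gen.splits)
    with True show ?thesis
      using eq1_square eq1_square_comp by (auto simp: normal_forms_def)
  next
    case h: False
    have "TComp (TGen h) n \<in> normal_forms \<and> wf1 ex_presentation (TComp (TGen h) n)"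
      using assms False h
      by (auto simp: normal_forms_def ex_presentation_def split: mor_gen.splits)
    then show ?thesis using eq1_refl by blast
  qed
qed

text \<open>With \<open>n\<close> arbitrary in the induction, a composite \<open>TComp t s\<close>
  is absorbed in two rounds: first \<open>s\<close> into \<open>n\<close>, then \<open>t\<close>
  into the result. Reassociation is needed only once, at the outermost level.\<close>

lemma comp_normal_form:
  assumes "wf1 ex_presentation t" "n \<in> normal_forms" "tdom ex_presentation t = tcod ex_presentation n"
  shows "\<exists>k\<in>normal_forms. eq1 ex_presentation (TComp t n) k"
  using assms
proof (induction t arbitrary: n)
  case (TId x)
  have "wf1 ex_presentation n"
    using TId by (auto simp: normal_forms_def ex_presentation_def)
  with TId show ?case using eq1_unit_left[of ex_presentation n] by auto
next
  case (TGen h)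
  then show ?case using generator_comp_normal_form by auto
next
  case (TComp t s)
  then obtain k where k: "k \<in> normal_forms" "eq1 ex_presentation (TComp s n) k" by auto
  have d: "tcod ex_presentation s = tcod ex_presentation k"
    using eq1_wf[OF wf_ex_presentation k(2)] by simp
  with TComp k obtain k' where k': "k' \<in> normal_forms" "eq1 ex_presentation (TComp t k) k'" by auto
  have "wf1 ex_presentation n"
    using TComp.prems by (auto simp: normal_forms_def ex_presentation_def)
  then have "eq1 ex_presentation (TComp (TComp t s) n) (TComp t (TComp s n))"
    using TComp.prems by (intro eq1_assoc) auto
  moreover have "eq1 ex_presentation (TComp t (TComp s n)) (TComp t k)"
    using TComp.prems k by (intro eq1_comp eq1_refl) auto
  ultimately show ?case using k' by (meson eq1_trans)
qed

lemma ex_normal_form: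
  assumes "wf1 ex_presentation t"
  shows "\<exists>n\<in>normal_forms. eq1 ex_presentation t n"
proof -
  have "TId (tdom ex_presentation t) \<in> normal_forms" by (simp add: normal_forms_def)
  then obtain n where "n \<in> normal_forms"
    "eq1 ex_presentation (TComp t (TId (tdom ex_presentation t))) n"
    using comp_normal_form[OF assms] by force
  then show ?thesis using eq1_unit_right[OF assms] by (meson eq1_sym eq1_trans)
qed

text \<open>Distinct parallel normal forms exist only from \<open>X\<close> to \<open>L\<close>,
  \<open>B\<close>, \<open>C\<close> and \<open>A\<close>. Each of these hom-sets has two, one
  ending its term in \<open>Gf\<close> and the other in \<open>Gg\<close>.\<close>

lemma normal_forms_inj:
  assumes "n \<in> normal_forms" "k \<in> normal_forms"
    and "tdom ex_presentation n = tdom ex_presentation k"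
    and "tcod ex_presentation n = tcod ex_presentation k"
    and "uses_g n = uses_g k"
  shows "n = k"
  using assms
  by (auto simp: normal_forms_def ex_presentation_def split: mor_gen.splits)

lemma eq1_ex_iff:
  assumes "wf1 ex_presentation t" "wf1 ex_presentation s"
  shows "eq1 ex_presentation t s \<longleftrightarrow> tdom ex_presentation t = tdom ex_presentation s \<and>
    tcod ex_presentation t = tcod ex_presentation s \<and> uses_g t = uses_g s" (is "?l \<longleftrightarrow> ?r")
proof
  assume ?l
  then show ?r using eq1_wf[OF wf_ex_presentation] eq1_uses_g by blast
next
  assume r: ?r
  obtain n k where nk: "n \<in> normal_forms" "eq1 ex_presentation t n"
    "k \<in> normal_forms" "eq1 ex_presentation s k"
    using assms ex_normal_form by metis
  then have "n = k"
    using r eq1_wf[OF wf_ex_presentation] eq1_uses_g by (intro normal_forms_inj) metis+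
  with nk show ?l by (meson eq1_sym eq1_trans)
qed

text \<open>Read off from the finite list of normal forms. These facts say which objects can map to
  which; in particular, an object with morphisms to both \<open>B\<close> and \<open>C\<close> is
  \<open>X\<close> or \<open>L\<close>.\<close>

lemma wf1_ex_shape:
  assumes "wf1 ex_presentation t"
  defines "x \<equiv> tdom ex_presentation t" and "y \<equiv> tcod ex_presentation t"
  shows "uses_g t \<Longrightarrow> x = GX \<and> y \<noteq> GX"
    and "y = GX \<Longrightarrow> x = GX" and "y = GL \<Longrightarrow> x \<in> {GX, GL}"
    and "y = GB \<Longrightarrow> x \<in> {GX, GL, GB}" and "y = GC \<Longrightarrow> x \<in> {GX, GL, GC}"
proof -
  obtain n where n: "n \<in> normal_forms" "eq1 ex_presentation t n"
    using assms ex_normal_form by metis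
  have e: "x = tdom ex_presentation n" "y = tcod ex_presentation n" "uses_g t = uses_g n"
    using eq1_wf[OF wf_ex_presentation n(2)] eq1_uses_g[OF n(2)] by (simp_all add: x_def y_def)
  show "uses_g t \<Longrightarrow> x = GX \<and> y \<noteq> GX"
    and "y = GX \<Longrightarrow> x = GX" and "y = GL \<Longrightarrow> x \<in> {GX, GL}"
    and "y = GB \<Longrightarrow> x \<in> {GX, GL, GB}" and "y = GC \<Longrightarrow> x \<in> {GX, GL, GC}"
    using n(1) unfolding e
    by (auto simp: normal_forms_def ex_presentation_def split: mor_gen.splits)
qed

section \<open>Morphisms of the presented 2-category as classes\<close>

lemmas ex_simps = presented_simps[OF wf_ex_presentation, folded ex_A_def]
lemmas ex_MorE = presented_MorE[OF wf_ex_presentation, folded ex_A_def]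
lemmas ex_MorI = presented_MorI[OF wf_ex_presentation, folded ex_A_def]
lemmas ex_CellE = presented_CellE[OF wf_ex_presentation, folded ex_A_def]
lemmas ex_CellI = presented_CellI[OF wf_ex_presentation, folded ex_A_def]

interpretation A: two_category ex_A
  by (rule two_category_ex_A)

text \<open>Since all representatives agree by \<open>eq1_uses_g\<close>, quantifying over them
  avoids choosing one.\<close>

definition thru_g :: "ex_mor \<Rightarrow> bool" where
  "thru_g m \<longleftrightarrow> (\<exists>t\<in>m. uses_g t)"

lemma thru_g_class1: "wf1 ex_presentation t \<Longrightarrow> thru_g (class1 ex_presentation t) = uses_g t"
  unfolding thru_g_def class1_def using eq1_uses_g eq1_refl by blast

lemma thru_g_Comp:
  "\<lbrakk>m \<in> Mor ex_A; n \<in> Mor ex_A; Dom ex_A m = Cod ex_A n\<rbrakk> \<Longrightarrow>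
    thru_g (Comp ex_A m n) = (thru_g m \<or> thru_g n)"
  by (elim ex_MorE) (simp add: ex_simps(5-) thru_g_class1)

lemma thru_g_Id1: "\<not> thru_g (Id1 ex_A x)"
  by (simp add: ex_simps(4) thru_g_class1)

lemma ex_gen_simps [simp]:
  "ex_gen h \<in> Mor ex_A"
  "Dom ex_A (ex_gen h) = gdom ex_presentation h"
  "Cod ex_A (ex_gen h) = gcod ex_presentation h"
  "thru_g (ex_gen h) \<longleftrightarrow> h = Gg"
  by (simp_all add: ex_gen_def ex_simps(5,6) ex_MorI thru_g_class1)

lemma ex_gdom_gcod [simp]:
  "gdom ex_presentation Gf = GX" "gdom ex_presentation Gg = GX"
  "gdom ex_presentation Glambda0 = GL" "gdom ex_presentation Glambda1 = GL"
  "gdom ex_presentation Gb = GB" "gdom ex_presentation Gc = GC"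
  "gcod ex_presentation Gf = GL" "gcod ex_presentation Gg = GL"
  "gcod ex_presentation Glambda0 = GB" "gcod ex_presentation Glambda1 = GC"
  "gcod ex_presentation Gb = GA" "gcod ex_presentation Gc = GA"
  by (simp_all add: ex_presentation_def)

lemma Obj_ex_A [simp]: "Obj ex_A = UNIV"
  by (simp add: ex_simps(1))

text \<open>Transfers the decision criterion \<open>eq1_ex_iff\<close> to classes, so that equations
  between morphisms can be checked without rewriting terms.\<close>

lemma ex_mor_eqI:
  assumes "m \<in> Mor ex_A" "n \<in> Mor ex_A"
    and "Dom ex_A m = Dom ex_A n" "Cod ex_A m = Cod ex_A n" "thru_g m = thru_g n"
  shows "m = n"
  using assms
  by (elim ex_MorE)
    (simp add: ex_simps(5,6) thru_g_class1 class1_eq_iff[OF wf_ex_presentation] eq1_ex_iff)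

lemma ex_mor_shape:
  assumes "m \<in> Mor ex_A"
  shows "thru_g m \<Longrightarrow> Dom ex_A m = GX \<and> Cod ex_A m \<noteq> GX"
    and "Cod ex_A m = GX \<Longrightarrow> Dom ex_A m = GX"
    and "Cod ex_A m = GL \<Longrightarrow> Dom ex_A m \<in> {GX, GL}"
    and "Cod ex_A m = GB \<Longrightarrow> Dom ex_A m \<in> {GX, GL, GB}"
    and "Cod ex_A m = GC \<Longrightarrow> Dom ex_A m \<in> {GX, GL, GC}"
proof -
  obtain t where t: "wf1 ex_presentation t" "m = class1 ex_presentation t"
    using assms by (elim ex_MorE)
  show "thru_g m \<Longrightarrow> Dom ex_A m = GX \<and> Cod ex_A m \<noteq> GX"
    and "Cod ex_A m = GX \<Longrightarrow> Dom ex_A m = GX"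
    and "Cod ex_A m = GL \<Longrightarrow> Dom ex_A m \<in> {GX, GL}"
    and "Cod ex_A m = GB \<Longrightarrow> Dom ex_A m \<in> {GX, GL, GB}"
    and "Cod ex_A m = GC \<Longrightarrow> Dom ex_A m \<in> {GX, GL, GC}"
    using wf1_ex_shape[OF t(1)] t by (simp_all add: ex_simps(5,6) thru_g_class1)
qed


section \<open>2-morphisms\<close>

definition ex_gamma :: "cell_gen \<Rightarrow> ex_cell" where
  "ex_gamma h = class2 ex_presentation (CGen h)"

definition b_gamma :: ex_cell where
  "b_gamma = wl ex_A (ex_gen Gb) (ex_gamma Ggamma0)"

lemma ex_gamma_simps [simp]:
  "ex_gamma h \<in> Cell ex_A"
  "Src ex_A (ex_gamma Ggamma0) = Comp ex_A (ex_gen Glambda0) (ex_gen Gf)"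
  "Tgt ex_A (ex_gamma Ggamma0) = Comp ex_A (ex_gen Glambda0) (ex_gen Gg)"
  "Src ex_A (ex_gamma Ggamma1) = Comp ex_A (ex_gen Glambda1) (ex_gen Gf)"
  "Tgt ex_A (ex_gamma Ggamma1) = Comp ex_A (ex_gen Glambda1) (ex_gen Gg)"
  by (simp_all add: ex_gamma_def ex_gen_def ex_simps(5-) ex_CellI)
    (simp_all add: ex_presentation_def)

lemma Comp_ex_simps [simp]:
  assumes "m \<in> Mor ex_A" "n \<in> Mor ex_A" "Dom ex_A m = Cod ex_A n"
  shows "Comp ex_A m n \<in> Mor ex_A" "Dom ex_A (Comp ex_A m n) = Dom ex_A n"
    "Cod ex_A (Comp ex_A m n) = Cod ex_A m" "thru_g (Comp ex_A m n) = (thru_g m \<or> thru_g n)"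
  using A.Comp_Mor assms thru_g_Comp by simp_all

lemma Id1_ex_simps [simp]:
  "Id1 ex_A x \<in> Mor ex_A" "Dom ex_A (Id1 ex_A x) = x" "Cod ex_A (Id1 ex_A x) = x"
  "\<not> thru_g (Id1 ex_A x)"
  using A.Id1_Mor thru_g_Id1 by simp_all

lemma Id2_ex_simps [simp]:
  assumes "m \<in> Mor ex_A"
  shows "Id2 ex_A m \<in> Cell ex_A" "Src ex_A (Id2 ex_A m) = m" "Tgt ex_A (Id2 ex_A m) = m"
  using A.Id2_Cell assms by simp_all

text \<open>This is the relation between 2-morphisms. Because of it one cell over \<open>A\<close>
  serves both legs of the cospan.\<close>

lemma c_gamma: "wl ex_A (ex_gen Gc) (ex_gamma Ggamma1) = b_gamma"
proof -
  let ?b = "CH (CId (TGen Gb)) (CGen Ggamma0)" and ?c = "CH (CId (TGen Gc)) (CGen Ggamma1)"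
  have rel: "eq2 ex_presentation ?b ?c"
    by (rule eq2_rel) (simp add: ex_presentation_def)
  then have "wf2 ex_presentation ?b" "wf2 ex_presentation ?c"
    using eq2_wf[OF wf_ex_presentation] by blast+
  then show ?thesis
    using class2_eq[OF wf_ex_presentation rel]
    by (simp add: b_gamma_def ex_gamma_def ex_gen_def ex_simps)
qed

lemma b_gamma_simps [simp]:
  "b_gamma \<in> Cell ex_A"
  "Src ex_A b_gamma = Comp ex_A (ex_gen Gb) (Comp ex_A (ex_gen Glambda0) (ex_gen Gf))"
  "Tgt ex_A b_gamma = Comp ex_A (ex_gen Gb) (Comp ex_A (ex_gen Glambda0) (ex_gen Gg))"
  using A.HComp_Cell[of "ex_gamma Ggamma0" "Id2 ex_A (ex_gen Gb)"]
  by (simp_all add: b_gamma_def)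

abbreviation gamma_cells :: "ex_cell set" where
  "gamma_cells \<equiv> {ex_gamma Ggamma0, ex_gamma Ggamma1, b_gamma}"

text \<open>The endpoints rule out composites of two such cells. Vertically, the first would end in
  a morphism through \<open>g\<close>, where the second cannot start. Horizontally, the outer cell
  would have to start at \<open>B\<close>, \<open>C\<close> or \<open>A\<close>, but it starts at
  \<open>X\<close>.\<close>

lemma gamma_cells_endpoints:
  assumes "\<alpha> \<in> gamma_cells"
  shows "\<not> thru_g (Src ex_A \<alpha>)" "thru_g (Tgt ex_A \<alpha>)"
    "Dom ex_A (Src ex_A \<alpha>) = GX" "Cod ex_A (Src ex_A \<alpha>) \<in> {GB, GC, GA}"
  using assms by auto

text \<open>A morphism into \<open>X\<close> is the identity, so right whiskering changes nothing. A
  morphism out of \<open>B\<close>, \<open>C\<close> or \<open>A\<close> is an identity,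
  \<open>b\<close> or \<open>c\<close>, and left whiskering by \<open>b\<close> or \<open>c\<close>
  yields \<open>b_gamma\<close>.\<close>

lemma whisker_gamma_cells:
  assumes "\<alpha> \<in> gamma_cells" "m \<in> Mor ex_A"
  shows "Dom ex_A m = Cod ex_A (Src ex_A \<alpha>) \<Longrightarrow> wl ex_A m \<alpha> \<in> gamma_cells"
    and "Cod ex_A m = GX \<Longrightarrow> wr ex_A \<alpha> m = \<alpha>"
proof -
  have \<alpha>: "\<alpha> \<in> Cell ex_A" using assms(1) by auto
  show "wr ex_A \<alpha> m = \<alpha>" if "Cod ex_A m = GX"
  proof -
    have "m = Id1 ex_A GX"
      using ex_mor_shape(1,2)[OF assms(2)] that assms(2) by (intro ex_mor_eqI) auto
    then show ?thesis
      using A.HComp_unit_right[OF \<alpha>] gamma_cells_endpoints(3)[OF assms(1)] by simp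
  qed
  show "wl ex_A m \<alpha> \<in> gamma_cells" if d: "Dom ex_A m = Cod ex_A (Src ex_A \<alpha>)"
  proof (cases "Cod ex_A m = Dom ex_A m")
    case True
    have "m = Id1 ex_A (Dom ex_A m)"
      using ex_mor_shape(1)[OF assms(2)] gamma_cells_endpoints(4)[OF assms(1)] d True assms(2)
      by (intro ex_mor_eqI) auto
    then show ?thesis using A.HComp_unit_left[OF \<alpha>] d assms(1) by simp
  next
    case False
    have g: "\<not> thru_g m"
      using ex_mor_shape(1)[OF assms(2)] gamma_cells_endpoints(4)[OF assms(1)] d by auto
    \<comment> \<open>Only \<open>A\<close> can be reached from \<open>B\<close> or \<open>C\<close>
      by a morphism that is no endomorphism, and from \<open>A\<close> nothing else can be
      reached.\<close>
    have cod: "Cod ex_A m = GA" "Dom ex_A m \<noteq> GA"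
      using ex_mor_shape(2-5)[OF assms(2)] gamma_cells_endpoints(4)[OF assms(1)] d False
      by (cases "Cod ex_A m"; auto)+
    then consider "\<alpha> = ex_gamma Ggamma0" "Dom ex_A m = GB" | "\<alpha> = ex_gamma Ggamma1" "Dom ex_A m = GC"
      using assms(1) d by auto
    then show ?thesis
    proof cases
      case 1
      then have "m = ex_gen Gb" using cod g assms(2) by (intro ex_mor_eqI) auto
      then show ?thesis using 1 by (simp add: b_gamma_def)
    next
      case 2
      then have "m = ex_gen Gc" using cod g assms(2) by (intro ex_mor_eqI) auto
      then show ?thesis using 2 by (simp add: c_gamma)
    qed
  qed
qed

text \<open>Induction over terms: the identities and the three gamma cells contain the generators
  and are closed under both compositions.\<close>

lemma ex_cell_cases:
  assumes "\<alpha> \<in> Cell ex_A"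
  shows "\<alpha> \<in> Id2 ex_A ` Mor ex_A \<union> gamma_cells"
proof -
  let ?S = "Id2 ex_A ` Mor ex_A \<union> gamma_cells"
  have S: "\<beta> \<in> Cell ex_A" if "\<beta> \<in> ?S" for \<beta> using that by auto
  have V: "VComp ex_A \<beta> \<alpha> \<in> ?S"
    if "\<alpha> \<in> ?S" "\<beta> \<in> ?S" "Src ex_A \<beta> = Tgt ex_A \<alpha>" for \<alpha> \<beta>
  proof (cases "\<beta> \<in> gamma_cells \<and> \<alpha> \<in> gamma_cells")
    case True
    then show ?thesis using gamma_cells_endpoints(1,2) that(3) by metis
  next
    case False
    then show ?thesis
      using that S[OF that(1)] S[OF that(2)] A.VComp_Id2[of \<beta>] A.Id2_VComp[of \<alpha>]
      by (elim UnE imageE) auto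
  qed
  have H: "HComp ex_A \<beta> \<alpha> \<in> ?S"
    if "\<alpha> \<in> ?S" "\<beta> \<in> ?S" "Dom ex_A (Src ex_A \<beta>) = Cod ex_A (Src ex_A \<alpha>)" for \<alpha> \<beta>
    using that(2,1)
  proof (elim UnE)
    assume "\<beta> \<in> Id2 ex_A ` Mor ex_A" "\<alpha> \<in> Id2 ex_A ` Mor ex_A"
    then show ?thesis using that(3) A.HComp_Id2 by auto
  next
    assume "\<beta> \<in> Id2 ex_A ` Mor ex_A" "\<alpha> \<in> gamma_cells"
    then have "HComp ex_A \<beta> \<alpha> \<in> gamma_cells"
      using that(3) whisker_gamma_cells(1)[of \<alpha>] by (elim imageE) (simp del: insert_iff)
    then show ?thesis ..
  next
    assume "\<beta> \<in> gamma_cells" "\<alpha> \<in> Id2 ex_A ` Mor ex_A"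
    then have "HComp ex_A \<beta> \<alpha> = \<beta>"
      using that(3) whisker_gamma_cells(2)[of \<beta>] gamma_cells_endpoints(3)[of \<beta>]
      by (elim imageE) (simp del: insert_iff)
    then show ?thesis using that(2) by simp
  next
    assume "\<beta> \<in> gamma_cells" "\<alpha> \<in> gamma_cells"
    then show ?thesis using that(3) gamma_cells_endpoints(3)[of \<beta>] gamma_cells_endpoints(4)[of \<alpha>] by simp
  qed
  have "class2 ex_presentation a \<in> ?S" if "wf2 ex_presentation a" for a
    using that
  proof (induction a)
    case (CId t)
    then show ?case using ex_simps(10)[of t] ex_MorI[of t] by (auto simp del: Id2_ex_simps)
  next
    case (CGen h)
    then show ?case by (cases h) (auto simp: ex_gamma_def)
  next
    case (CV b a)
    \<comment> \<open>Well-formedness of a vertical composite matches the boundaries only up to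
      \<open>eq1\<close>; on classes this becomes an equality, as the closure property
      \<open>V\<close> demands.\<close>
    then have "Src ex_A (class2 ex_presentation b) = Tgt ex_A (class2 ex_presentation a)"
      by (simp add: ex_simps class1_eq[OF wf_ex_presentation])
    moreover have "class2 ex_presentation a \<in> ?S" "class2 ex_presentation b \<in> ?S"
      using CV by simp_all
    ultimately show ?case using V by (simp only: ex_simps(11)[OF CV.prems, symmetric])
  next
    case (CH b a)
    then have "Dom ex_A (Src ex_A (class2 ex_presentation b)) =
        Cod ex_A (Src ex_A (class2 ex_presentation a))"
      by (simp add: ex_simps wf2_csrc[OF wf_ex_presentation])
    moreover have "class2 ex_presentation a \<in> ?S" "class2 ex_presentation b \<in> ?S"
      using CH by simp_all
    ultimately show ?case using H by (simp only: ex_simps(12)[OF CH.prems, symmetric])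
  qed
  then show ?thesis using assms by (elim ex_CellE) simp
qed

section \<open>Consequences for 2-morphisms with restricted endpoints\<close>

lemma ex_cell_Id2:
  assumes "\<alpha> \<in> Cell ex_A" "thru_g (Tgt ex_A \<alpha>) \<Longrightarrow> thru_g (Src ex_A \<alpha>)"
  shows "\<alpha> = Id2 ex_A (Src ex_A \<alpha>)" "Tgt ex_A \<alpha> = Src ex_A \<alpha>"
proof -
  have "\<alpha> \<notin> gamma_cells"
    using assms(2) gamma_cells_endpoints(1,2) by metis
  then obtain m where "m \<in> Mor ex_A" "\<alpha> = Id2 ex_A m"
    using ex_cell_cases[OF assms(1)] by blast
  then show "\<alpha> = Id2 ex_A (Src ex_A \<alpha>)" "Tgt ex_A \<alpha> = Src ex_A \<alpha>"
    by simp_all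
qed

text \<open>The gamma cells live over \<open>B\<close>, \<open>C\<close> and \<open>A\<close>, so
  only identities remain over \<open>L\<close>. This is the obstruction to lifting the modification
  below.\<close>

lemma ex_cell_into_L:
  assumes "\<alpha> \<in> Cell ex_A" "Cod ex_A (Src ex_A \<alpha>) = GL"
  shows "Tgt ex_A \<alpha> = Src ex_A \<alpha>"
proof -
  have "\<alpha> \<notin> gamma_cells"
    using gamma_cells_endpoints(4)[of \<alpha>] assms(2) by (auto simp del: insert_iff)
  then obtain m where "m \<in> Mor ex_A" "\<alpha> = Id2 ex_A m"
    using ex_cell_cases[OF assms(1)] by blast
  then show ?thesis by simp
qed

text \<open>An inverse of a gamma cell would lead from a morphism through \<open>g\<close> to one
  that avoids \<open>g\<close>, which no 2-morphism does.\<close>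

lemma invertible_ex_cell:
  assumes "invertible_cell ex_A \<alpha>"
  shows "\<alpha> = Id2 ex_A (Src ex_A \<alpha>)" "Tgt ex_A \<alpha> = Src ex_A \<alpha>"
proof -
  obtain \<beta> where \<beta>: "\<alpha> \<in> Cell ex_A" "\<beta> \<in> Cell ex_A" "Src ex_A \<beta> = Tgt ex_A \<alpha>" "Tgt ex_A \<beta> = Src ex_A \<alpha>"
    using assms by (auto simp: invertible_cell_def)
  have "thru_g (Src ex_A \<alpha>)" if "thru_g (Tgt ex_A \<alpha>)"
    using ex_cell_Id2(2)[OF \<beta>(2)] that \<beta> by auto
  then show "\<alpha> = Id2 ex_A (Src ex_A \<alpha>)" "Tgt ex_A \<alpha> = Src ex_A \<alpha>"
    using ex_cell_Id2[OF \<beta>(1)] by blast+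
qed


section \<open>Pseudo-cones\<close>

lemma (in two_category) invertible_Id2: "f \<in> Mor A \<Longrightarrow> invertible_cell A (Id2 A f)"
  using Id2_Cell[of f] Id2_VComp[of "Id2 A f"] unfolding invertible_cell_def by force

lemma is_two_functor_\<Delta>0:
  assumes "two_category I" "two_category A" "x \<in> Obj A"
  shows "is_two_functor I A (\<Delta>0 I A x)"
proof -
  interpret I: two_category I by fact
  interpret A: two_category A by fact
  have id: "Id1 A x \<in> Mor A" "Dom A (Id1 A x) = x" "Cod A (Id1 A x) = x"
    using A.Id1_Mor assms(3) by auto
  have id2: "Id2 A (Id1 A x) \<in> Cell A" "Src A (Id2 A (Id1 A x)) = Id1 A x"
    "Tgt A (Id2 A (Id1 A x)) = Id1 A x"
    using A.Id2_Cell id by auto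
  show ?thesis
    using assms(3) id id2 I.Dom_Obj I.Cod_Obj I.Id1_Mor I.Comp_Mor I.Src_Mor I.Tgt_Mor I.Id2_Cell
      I.VComp_Cell I.HComp_Cell A.Comp_Id1[of "Id1 A x"] A.VComp_Id2[of "Id2 A (Id1 A x)"]
      A.HComp_Id2[of "Id1 A x" "Id1 A x"]
    unfolding is_two_functor_def \<Delta>0_def by auto
qed

lemma cospan_carriers [simp]:
  "Obj cospan = UNIV" "Mor cospan = UNIV" "Cell cospan = UNIV"
  "Dom cospan = cospan_src" "Cod cospan = cospan_tgt" "Id1 cospan = IdAt"
  "Src cospan = id" "Tgt cospan = id" "Id2 cospan = id"
  by (simp_all add: cospan_simps)

lemma cospan_Comp:
  assumes "cospan_src v = cospan_tgt u"
  shows "cospan_src (Comp cospan v u) = cospan_src u" "cospan_tgt (Comp cospan v u) = cospan_tgt v"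
  using two_category.Comp_Mor[OF two_category_cospan, of u v] assms by simp_all

lemma ex_F_simps [simp]:
  "F0 ex_F PtB = GB" "F0 ex_F PtA = GA" "F0 ex_F PtC = GC"
  "F1 ex_F (IdAt i) = Id1 ex_A (F0 ex_F i)" "F1 ex_F ArB = ex_gen Gb" "F1 ex_F ArC = ex_gen Gc"
  "F2 ex_F u = Id2 ex_A (F1 ex_F u)"
  by (simp_all add: ex_F_def Let_def)

lemma F1_ex_F [simp]:
  "F1 ex_F u \<in> Mor ex_A" "Dom ex_A (F1 ex_F u) = F0 ex_F (cospan_src u)"
  "Cod ex_A (F1 ex_F u) = F0 ex_F (cospan_tgt u)"
  by (cases u; simp)+

lemma F1_ex_F_Comp:
  assumes "cospan_src v = cospan_tgt u"
  shows "F1 ex_F (Comp cospan v u) = Comp ex_A (F1 ex_F v) (F1 ex_F u)"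
proof (cases v)
  case (IdAt i)
  then show ?thesis using assms A.Id1_Comp[of "F1 ex_F u"] by (simp add: cospan_simps)
next
  case ArB
  then show ?thesis
    using assms A.Comp_Id1[of "F1 ex_F v"] by (cases u) (simp_all add: cospan_simps)
next
  case ArC
  then show ?thesis
    using assms A.Comp_Id1[of "F1 ex_F v"] by (cases u) (simp_all add: cospan_simps)
qed

lemma HComp_Id2_ex [simp]:
  "\<lbrakk>m \<in> Mor ex_A; n \<in> Mor ex_A; Dom ex_A m = Cod ex_A n\<rbrakk> \<Longrightarrow>
    HComp ex_A (Id2 ex_A m) (Id2 ex_A n) = Id2 ex_A (Comp ex_A m n)"
  by (rule A.HComp_Id2)

lemma VComp_Id2_ex [simp]:
  "m \<in> Mor ex_A \<Longrightarrow> VComp ex_A (Id2 ex_A m) (Id2 ex_A m) = Id2 ex_A m"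
  using A.VComp_Id2[of "Id2 ex_A m"] by simp

lemma Comp_Id1_ex [simp]:
  "\<lbrakk>m \<in> Mor ex_A; x = Dom ex_A m\<rbrakk> \<Longrightarrow> Comp ex_A m (Id1 ex_A x) = m"
  "\<lbrakk>m \<in> Mor ex_A; x = Cod ex_A m\<rbrakk> \<Longrightarrow> Comp ex_A (Id1 ex_A x) m = m"
  using A.Comp_Id1 A.Id1_Comp by auto

lemma is_two_functor_ex_F: "is_two_functor cospan ex_A ex_F"
  unfolding is_two_functor_def
  by (auto simp: PiE_def extensional_def F1_ex_F_Comp cospan_simps(10,11))

text \<open>Invertible 2-morphisms of the example are identities, so every pseudo-cone over the
  diagram is of the following form.\<close>

definition strict_cone ::
  "ob_gen \<Rightarrow> ex_mor \<Rightarrow> ex_mor \<Rightarrow> (cospan_ob, cospan_ar, cospan_ar, ob_gen, ex_mor, ex_cell) ps_nat" where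
  "strict_cone x p q = (let
       l = (\<lambda>i. case i of PtB \<Rightarrow> p | PtA \<Rightarrow> Comp ex_A (ex_gen Gb) p | PtC \<Rightarrow> q)
     in \<lparr>nsrc = \<Delta>0 cospan ex_A x, ntgt = ex_F,
         ncomp = l, ncell = (\<lambda>u. Id2 ex_A (l (cospan_tgt u)))\<rparr>)"

lemma strict_cone_simps [simp]:
  "nsrc (strict_cone x p q) = \<Delta>0 cospan ex_A x" "ntgt (strict_cone x p q) = ex_F"
  "ncomp (strict_cone x p q) PtB = p" "ncomp (strict_cone x p q) PtC = q"
  "ncomp (strict_cone x p q) PtA = Comp ex_A (ex_gen Gb) p"
  "ncell (strict_cone x p q) u = Id2 ex_A (ncomp (strict_cone x p q) (cospan_tgt u))"
  by (simp_all add: strict_cone_def Let_def)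

lemma ex_lambda_eq: "ex_lambda = strict_cone GL (ex_gen Glambda0) (ex_gen Glambda1)"
  by (simp add: ex_lambda_def strict_cone_def)

definition commuting_legs :: "ob_gen \<Rightarrow> ex_mor \<Rightarrow> ex_mor \<Rightarrow> bool" where
  "commuting_legs x p q \<longleftrightarrow> p \<in> Mor ex_A \<and> Dom ex_A p = x \<and> Cod ex_A p = GB \<and>
     q \<in> Mor ex_A \<and> Dom ex_A q = x \<and> Cod ex_A q = GC \<and>
     Comp ex_A (ex_gen Gb) p = Comp ex_A (ex_gen Gc) q"

text \<open>Neither \<open>b\<close> nor \<open>c\<close> passes through \<open>g\<close>, so the
  two composites into \<open>A\<close> are parallel and pass through \<open>g\<close> exactly when
  \<open>p\<close>, respectively \<open>q\<close>, does.\<close>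

lemma commuting_legs_iff:
  "commuting_legs x p q \<longleftrightarrow> p \<in> Mor ex_A \<and> Dom ex_A p = x \<and> Cod ex_A p = GB \<and>
     q \<in> Mor ex_A \<and> Dom ex_A q = x \<and> Cod ex_A q = GC \<and> thru_g p = thru_g q"
proof -
  have "Comp ex_A (ex_gen Gb) p = Comp ex_A (ex_gen Gc) q \<longleftrightarrow> thru_g p = thru_g q"
    if "p \<in> Mor ex_A" "Dom ex_A p = x" "Cod ex_A p = GB"
     "q \<in> Mor ex_A" "Dom ex_A q = x" "Cod ex_A q = GC"
  proof
    assume "Comp ex_A (ex_gen Gb) p = Comp ex_A (ex_gen Gc) q"
    then have "thru_g (Comp ex_A (ex_gen Gb) p) = thru_g (Comp ex_A (ex_gen Gc) q)" by simp
    with that show "thru_g p = thru_g q" by simp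
  next
    assume "thru_g p = thru_g q"
    with that show "Comp ex_A (ex_gen Gb) p = Comp ex_A (ex_gen Gc) q"
      by (intro ex_mor_eqI) simp_all
  qed
  then show ?thesis unfolding commuting_legs_def by blast
qed

lemma ncomp_strict_cone [simp]:
  assumes "commuting_legs x p q"
  shows "ncomp (strict_cone x p q) i \<in> Mor ex_A" "Dom ex_A (ncomp (strict_cone x p q) i) = x"
    "Cod ex_A (ncomp (strict_cone x p q) i) = F0 ex_F i"
    "cospan_src u = i \<Longrightarrow>
      Comp ex_A (F1 ex_F u) (ncomp (strict_cone x p q) i) = ncomp (strict_cone x p q) (cospan_tgt u)"
proof -
  have *: "ncomp (strict_cone x p q) i \<in> Mor ex_A \<and> Dom ex_A (ncomp (strict_cone x p q) i) = x
    \<and> Cod ex_A (ncomp (strict_cone x p q) i) = F0 ex_F i" for i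
    using assms by (cases i) (simp_all add: commuting_legs_def)
  then show "ncomp (strict_cone x p q) i \<in> Mor ex_A" "Dom ex_A (ncomp (strict_cone x p q) i) = x"
    "Cod ex_A (ncomp (strict_cone x p q) i) = F0 ex_F i"
    by blast+
  show "Comp ex_A (F1 ex_F u) (ncomp (strict_cone x p q) i) = ncomp (strict_cone x p q) (cospan_tgt u)"
    if "cospan_src u = i"
    using that * assms by (cases u) (auto simp: commuting_legs_def)
qed

lemma \<Delta>0_simps [simp]:
  "F0 (\<Delta>0 cospan ex_A x) i = x" "F1 (\<Delta>0 cospan ex_A x) u = Id1 ex_A x"
  "F2 (\<Delta>0 cospan ex_A x) u = Id2 ex_A (Id1 ex_A x)"
  by (simp_all add: \<Delta>0_def)

lemma is_two_functor_\<Delta>0_ex: "is_two_functor cospan ex_A (\<Delta>0 cospan ex_A x)"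
  by (rule is_two_functor_\<Delta>0[OF two_category_cospan two_category_ex_A]) simp

lemma is_ps_nat_strict_cone:
  assumes "commuting_legs x p q"
  shows "is_ps_nat cospan ex_A (strict_cone x p q)"
  using assms unfolding is_ps_nat_def Let_def
  by (auto simp: is_two_functor_\<Delta>0_ex is_two_functor_ex_F A.invertible_Id2 cospan_Comp
      PiE_def extensional_def)

text \<open>The structure 2-morphisms are invertible, hence identities, which forces the triangles
  to commute strictly. The triangle at \<open>ArB\<close> determines the component at
  \<open>PtA\<close>, and the one at \<open>ArC\<close> makes the legs commute.\<close>

lemma ps_nat_eq_strict_cone:
  assumes "is_ps_nat cospan ex_A \<mu>" "nsrc \<mu> = \<Delta>0 cospan ex_A x" "ntgt \<mu> = ex_F"
  shows "commuting_legs x (ncomp \<mu> PtB) (ncomp \<mu> PtC)"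
    "\<mu> = strict_cone x (ncomp \<mu> PtB) (ncomp \<mu> PtC)"
proof -
  have mor: "ncomp \<mu> i \<in> Mor ex_A" and dom: "Dom ex_A (ncomp \<mu> i) = x"
    and cod: "Cod ex_A (ncomp \<mu> i) = F0 ex_F i"
    and inv: "invertible_cell ex_A (ncell \<mu> u)"
    and src: "Src ex_A (ncell \<mu> u) = Comp ex_A (F1 ex_F u) (ncomp \<mu> (cospan_src u))"
    and tgt: "Tgt ex_A (ncell \<mu> u) = Comp ex_A (ncomp \<mu> (cospan_tgt u)) (Id1 ex_A x)" for i u
    using assms unfolding is_ps_nat_def Let_def by (auto simp: PiE_def Pi_def)
  have tgt': "Tgt ex_A (ncell \<mu> u) = ncomp \<mu> (cospan_tgt u)" for u
    using tgt mor dom by simp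
  have eq: "Comp ex_A (F1 ex_F u) (ncomp \<mu> (cospan_src u)) = ncomp \<mu> (cospan_tgt u)" for u
    using invertible_ex_cell(2)[OF inv[of u]] src tgt' by simp
  have cell: "ncell \<mu> u = Id2 ex_A (ncomp \<mu> (cospan_tgt u))" for u
    using invertible_ex_cell[OF inv[of u]] tgt'[of u] by simp
  show "commuting_legs x (ncomp \<mu> PtB) (ncomp \<mu> PtC)"
    using mor dom cod eq[of ArB] eq[of ArC] by (simp add: commuting_legs_def)
  have comp: "ncomp \<mu> i = ncomp (strict_cone x (ncomp \<mu> PtB) (ncomp \<mu> PtC)) i" for i
    using eq[of ArB] by (cases i) simp_all
  \<comment> \<open>The carriers of the shape are whole types, so agreement on them is equality of
    functions and no default values occur.\<close>
  have "ncomp \<mu> = ncomp (strict_cone x (ncomp \<mu> PtB) (ncomp \<mu> PtC))"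
    by (rule ext) (rule comp)
  moreover have "ncell \<mu> = ncell (strict_cone x (ncomp \<mu> PtB) (ncomp \<mu> PtC))"
    by (rule ext) (simp only: cell strict_cone_simps(6) comp[symmetric])
  ultimately show "\<mu> = strict_cone x (ncomp \<mu> PtB) (ncomp \<mu> PtC)"
    by (intro ps_nat.equality) (assumption | simp (no_asm) add: assms(2,3))+
qed

lemma is_ps_cone_ex_iff:
  "is_ps_cone cospan ex_A ex_F x \<mu> \<longleftrightarrow> (\<exists>p q. commuting_legs x p q \<and> \<mu> = strict_cone x p q)"
  using is_ps_nat_strict_cone ps_nat_eq_strict_cone[of \<mu> x]
  by (auto simp: is_ps_cone_def Ps_def)

section \<open>Factorization of cones through \<open>ex_lambda\<close>\<close>

lemma legs_comp:
  assumes "h \<in> Mor ex_A" "Cod ex_A h = GL"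
  shows "commuting_legs (Dom ex_A h) (Comp ex_A (ex_gen Glambda0) h) (Comp ex_A (ex_gen Glambda1) h)"
  using assms by (simp add: commuting_legs_iff)

lemma commuting_legs_lambda: "commuting_legs GL (ex_gen Glambda0) (ex_gen Glambda1)"
  by (simp add: commuting_legs_iff)

lemma is_ps_cone_ex_lambda: "is_ps_cone cospan ex_A ex_F GL ex_lambda"
  unfolding is_ps_cone_ex_iff ex_lambda_eq using commuting_legs_lambda by blast

lemma ex_lambda_comp:
  assumes "h \<in> Mor ex_A" "Cod ex_A h = GL"
  shows "Comp (Ps cospan ex_A) ex_lambda (\<Delta>1 cospan ex_A h) =
    strict_cone (Dom ex_A h) (Comp ex_A (ex_gen Glambda0) h) (Comp ex_A (ex_gen Glambda1) h)"
    (is "?l = ?r")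
proof -
  note comp = ncomp_strict_cone(1-3)[OF commuting_legs_lambda]
    ncomp_strict_cone(1)[OF legs_comp[OF assms]]
  have "Comp ex_A (ncomp ex_lambda i) h = ncomp ?r i" for i
    unfolding ex_lambda_eq
    using assms by (cases i) (simp_all add: A.Comp_assoc)
  then show ?thesis
    unfolding Ps_def ps_comp_def \<Delta>1_def
    using assms comp ncomp_strict_cone(4)[OF commuting_legs_lambda]
    by (intro ps_nat.equality) (auto simp: ex_lambda_eq intro!: ext)
qed

text \<open>Legs to both \<open>B\<close> and \<open>C\<close> exist only from \<open>X\<close> and
  \<open>L\<close>. The factorization must pass through \<open>g\<close> exactly when
  \<open>p\<close> does, and this together with its endpoints determines it.\<close>

lemma ex_cone_factorization:
  assumes "commuting_legs x p q"
  shows "\<exists>!h. h \<in> Mor ex_A \<and> Dom ex_A h = x \<and> Cod ex_A h = GL \<and>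
    Comp (Ps cospan ex_A) ex_lambda (\<Delta>1 cospan ex_A h) = strict_cone x p q"
proof (rule ex_ex1I)
  note legs = assms[unfolded commuting_legs_iff]
  have "x = GX \<or> x = GL"
    using ex_mor_shape(4)[of p] ex_mor_shape(5)[of q] legs by auto
  then obtain h where h: "h \<in> Mor ex_A" "Dom ex_A h = x" "Cod ex_A h = GL" "thru_g h = thru_g p"
  proof (elim disjE)
    \<comment> \<open>From \<open>X\<close> the two candidates \<open>f\<close> and \<open>g\<close>
      realize both values of \<open>thru_g\<close>. From \<open>L\<close> no leg passes through
      \<open>g\<close>, so the identity has the required value.\<close>
    assume "x = GX"
    then show ?thesis
      using that[of "ex_gen Gf"] that[of "ex_gen Gg"] by simp blast
  next
    assume "x = GL"
    then show ?thesis
      using that[of "Id1 ex_A GL"] ex_mor_shape(1)[of p] legs by auto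
  qed
  then have "Comp ex_A (ex_gen Glambda0) h = p" "Comp ex_A (ex_gen Glambda1) h = q"
    using legs by (intro ex_mor_eqI; simp)+
  with h show "\<exists>h. h \<in> Mor ex_A \<and> Dom ex_A h = x \<and> Cod ex_A h = GL \<and>
    Comp (Ps cospan ex_A) ex_lambda (\<Delta>1 cospan ex_A h) = strict_cone x p q"
    using ex_lambda_comp by auto
next
  have "thru_g h = thru_g p" if "h \<in> Mor ex_A" "Cod ex_A h = GL"
    "Comp (Ps cospan ex_A) ex_lambda (\<Delta>1 cospan ex_A h) = strict_cone x p q" for h
  proof -
    \<comment> \<open>The component at \<open>PtB\<close> alone recovers \<open>thru_g h\<close>,
      because \<open>lambda0\<close> does not pass through \<open>g\<close>.\<close>
    have "Comp ex_A (ex_gen Glambda0) h = p"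
      using that ex_lambda_comp[of h] by (metis strict_cone_simps(3))
    then have "thru_g (Comp ex_A (ex_gen Glambda0) h) = thru_g p" by simp
    with that(1,2) show ?thesis by simp
  qed
  then show "h = k"
    if "h \<in> Mor ex_A \<and> Dom ex_A h = x \<and> Cod ex_A h = GL \<and>
        Comp (Ps cospan ex_A) ex_lambda (\<Delta>1 cospan ex_A h) = strict_cone x p q"
      "k \<in> Mor ex_A \<and> Dom ex_A k = x \<and> Cod ex_A k = GL \<and>
        Comp (Ps cospan ex_A) ex_lambda (\<Delta>1 cospan ex_A k) = strict_cone x p q" for h k
    using that by (intro ex_mor_eqI) simp_all
qed

text \<open>Supplies the condition for \<open>Id2 ex_A h\<close> to be a 2-morphism of the
  strict-slice.\<close>

lemma ex_lambda_whisker_Id2: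
  assumes "h \<in> Mor ex_A" "Cod ex_A h = GL"
  shows "wl (Ps cospan ex_A) ex_lambda (\<Delta>2 cospan ex_A (Id2 ex_A h)) =
    Id2 (Ps cospan ex_A) (Comp (Ps cospan ex_A) ex_lambda (\<Delta>1 cospan ex_A h))"
  using assms ncomp_strict_cone[OF commuting_legs_lambda]
  by (auto simp: Ps_def \<Delta>2_def ps_comp_def \<Delta>1_def ex_lambda_eq)

section \<open>Hom-categories of the strict-slice\<close>

lemma isomorphic_terminal_cat:
  assumes "Ob C = {x}" "Ar C = {f}" "Sr C f = x" "Tr C f = x" "Idt C x = f" "Cmp C f f = f"
  shows "isomorphic_cats C terminal_cat"
  unfolding isomorphic_cats_def is_cat_isomorphism_def
  by (rule exI[of _ "\<lambda>_. ()"], rule exI[of _ "\<lambda>_. ()"], intro conjI exI[of _ "\<lambda>_. x"] exI[of _ "\<lambda>_. f"])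
    (simp_all add: assms is_functor_def terminal_cat_def)

lemma slice_mors_iff:
  "((x, \<mu>), (y, \<nu>), f) \<in> slice_mors I A F \<longleftrightarrow> is_ps_cone I A F x \<mu> \<and> is_ps_cone I A F y \<nu> \<and>
     f \<in> Mor A \<and> Dom A f = x \<and> Cod A f = y \<and> Comp (Ps I A) \<nu> (\<Delta>1 I A f) = \<mu>"
  unfolding slice_mors_def by auto

lemma slice_cells_iff:
  "(((x, \<mu>), (y, \<nu>), f), ((x', \<mu>'), (y', \<nu>'), g), \<alpha>) \<in> slice_cells I A F \<longleftrightarrow>
     x' = x \<and> \<mu>' = \<mu> \<and> y' = y \<and> \<nu>' = \<nu> \<and>
     ((x, \<mu>), (y, \<nu>), f) \<in> slice_mors I A F \<and> ((x, \<mu>), (y, \<nu>), g) \<in> slice_mors I A F \<and>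
     \<alpha> \<in> Cell A \<and> Src A \<alpha> = f \<and> Tgt A \<alpha> = g \<and>
     wl (Ps I A) \<nu> (\<Delta>2 I A \<alpha>) = Id2 (Ps I A) \<mu>"
  unfolding slice_cells_def by auto

text \<open>Unique factorization leaves one morphism \<open>h\<close> from each pseudo-cone. A
  2-morphism of the slice then has \<open>h\<close> as source and target, so it is the identity of
  \<open>h\<close>.\<close>

lemma two_terminal_ex_lambda: "two_terminal (strict_slice cospan ex_A ex_F) (GL, ex_lambda)"
  unfolding two_terminal_def
proof (intro conjI ballI)
  let ?S = "strict_slice cospan ex_A ex_F"
  show "(GL, ex_lambda) \<in> Obj ?S"
    using is_ps_cone_ex_lambda by (simp add: strict_slice_def Let_def)
  fix X
  assume "X \<in> Obj ?S"
  then obtain x \<mu> where X: "X = (x, \<mu>)" and \<mu>: "is_ps_cone cospan ex_A ex_F x \<mu>"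
    by (auto simp: strict_slice_def Let_def)
  define Q where "Q h \<longleftrightarrow> h \<in> Mor ex_A \<and> Dom ex_A h = x \<and> Cod ex_A h = GL \<and>
    Comp (Ps cospan ex_A) ex_lambda (\<Delta>1 cospan ex_A h) = \<mu>" for h
  obtain p q where "commuting_legs x p q" "\<mu> = strict_cone x p q"
    using \<mu> unfolding is_ps_cone_ex_iff by blast
  then have "\<exists>!h. Q h"
    using ex_cone_factorization by (simp add: Q_def)
  then obtain h where Q: "Q k \<longleftrightarrow> k = h" for k by blast
  then have h: "h \<in> Mor ex_A" "Dom ex_A h = x" "Cod ex_A h = GL"
    "Comp (Ps cospan ex_A) ex_lambda (\<Delta>1 cospan ex_A h) = \<mu>"
    unfolding Q_def by blast+
  let ?m = "(X, (GL, ex_lambda), h)"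
  let ?a = "(?m, ?m, Id2 ex_A h)"
  have mor: "((x, \<mu>), (GL, ex_lambda), k) \<in> slice_mors cospan ex_A ex_F \<longleftrightarrow> k = h" for k
    using \<mu> is_ps_cone_ex_lambda by (simp add: slice_mors_iff Q_def Q[symmetric])
  \<comment> \<open>The two projections are the domain and codomain of the source of
    \<open>a\<close>, in the form in which \<open>hom_cat\<close> unfolds.\<close>
  have cell: "a \<in> slice_cells cospan ex_A ex_F \<and> fst (fst a) = X \<and> fst (snd (fst a)) = (GL, ex_lambda)
      \<longleftrightarrow> a = ?a" for a
  proof -
    obtain x1 \<mu>1 y1 \<nu>1 f x2 \<mu>2 y2 \<nu>2 g \<alpha>
      where a: "a = (((x1, \<mu>1), (y1, \<nu>1), f), ((x2, \<mu>2), (y2, \<nu>2), g), \<alpha>)"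
      by (metis surj_pair)
    show ?thesis
    proof
      assume L: "a \<in> slice_cells cospan ex_A ex_F \<and> fst (fst a) = X \<and>
        fst (snd (fst a)) = (GL, ex_lambda)"
      then have 1: "x1 = x" "\<mu>1 = \<mu>" "y1 = GL" "\<nu>1 = ex_lambda"
        unfolding a X by simp_all
      with L have 2: "x2 = x" "\<mu>2 = \<mu>" "y2 = GL" "\<nu>2 = ex_lambda" "f = h" "g = h"
        "\<alpha> \<in> Cell ex_A" "Src ex_A \<alpha> = f" "Tgt ex_A \<alpha> = g"
        unfolding a by (simp_all add: slice_cells_iff mor)
      then have "\<alpha> = Id2 ex_A h"
        using ex_cell_Id2(1)[of \<alpha>] by simp
      then show "a = ?a"
        unfolding a X using 1 2 by simp
    next
      assume "a = ?a"
      then show "a \<in> slice_cells cospan ex_A ex_F \<and> fst (fst a) = X \<and>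
        fst (snd (fst a)) = (GL, ex_lambda)"
        unfolding X using h ex_lambda_whisker_Id2[of h] by (simp add: slice_cells_iff mor)
    qed
  qed
  have "isomorphic_cats (hom_cat ?S X (GL, ex_lambda)) terminal_cat"
  proof (rule isomorphic_terminal_cat[of _ ?m ?a])
    have "m = ?m \<longleftrightarrow> m \<in> slice_mors cospan ex_A ex_F \<and> fst m = X \<and> fst (snd m) = (GL, ex_lambda)" for m
      using mor unfolding X by (cases m) auto
    then show "Ob (hom_cat ?S X (GL, ex_lambda)) = {?m}"
      by (simp add: hom_cat_def strict_slice_def Let_def case_prod_beta) blast
    show "Ar (hom_cat ?S X (GL, ex_lambda)) = {?a}"
      using cell by (simp add: hom_cat_def strict_slice_def Let_def case_prod_beta)
  qed (use h in \<open>simp_all add: hom_cat_def strict_slice_def Let_def\<close>)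
  then show "isomorphic_cats (hom_cat ?S X (GL, ex_lambda)) terminal_cat" .
qed


section \<open>The modification that is not induced by a 2-morphism\<close>

definition gamma_modification ::
  "(cospan_ob, cospan_ar, cospan_ar, ob_gen, ex_mor, ex_cell) modification" where
  "gamma_modification =
    \<lparr>msrc = Comp (Ps cospan ex_A) ex_lambda (\<Delta>1 cospan ex_A (ex_gen Gf)),
     mtgt = Comp (Ps cospan ex_A) ex_lambda (\<Delta>1 cospan ex_A (ex_gen Gg)),
     mcomp = (\<lambda>i. case i of PtB \<Rightarrow> ex_gamma Ggamma0 | PtA \<Rightarrow> b_gamma | PtC \<Rightarrow> ex_gamma Ggamma1)\<rparr>"

text \<open>The structure 2-morphisms of both cones are identities, so the modification law says
  that whiskering the component at the source of an arrow gives the one at its target. At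
  \<open>ArB\<close> this defines \<open>b_gamma\<close>; at \<open>ArC\<close> it is
  \<open>c_gamma\<close>.\<close>

lemma is_modification_gamma: "is_modification cospan ex_A gamma_modification"
proof -
  define p where "p = mcomp gamma_modification"
  have p: "p PtB = ex_gamma Ggamma0" "p PtA = b_gamma" "p PtC = ex_gamma Ggamma1"
    by (simp_all add: p_def gamma_modification_def)
  define \<mu> where "\<mu> h = Comp (Ps cospan ex_A) ex_lambda (\<Delta>1 cospan ex_A (ex_gen h))" for h
  have \<mu>: "\<mu> h = strict_cone GX (Comp ex_A (ex_gen Glambda0) (ex_gen h)) (Comp ex_A (ex_gen Glambda1) (ex_gen h))"
    and legs: "commuting_legs GX (Comp ex_A (ex_gen Glambda0) (ex_gen h)) (Comp ex_A (ex_gen Glambda1) (ex_gen h))"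
    if "h = Gf \<or> h = Gg" for h
    using that ex_lambda_comp[of "ex_gen h"] legs_comp[of "ex_gen h"] by (auto simp: \<mu>_def)
  have nat: "is_ps_nat cospan ex_A (\<mu> h)" if "h = Gf \<or> h = Gg" for h
    using \<mu> legs is_ps_nat_strict_cone that by simp
  have cell: "p i \<in> Cell ex_A" "Dom ex_A (Src ex_A (p i)) = GX" "Cod ex_A (Src ex_A (p i)) = F0 ex_F i" for i
    by (cases i; simp add: p)+
  have ends: "Src ex_A (p i) = ncomp (\<mu> Gf) i" "Tgt ex_A (p i) = ncomp (\<mu> Gg) i" for i
    by (cases i; simp add: p \<mu>)+
  have nat_p: "wl ex_A (F1 ex_F u) (p (cospan_src u)) = p (cospan_tgt u)" for u
  proof (cases u)
    case (IdAt i)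
    then show ?thesis using A.HComp_unit_left[OF cell(1)[of i]] cell by simp
  qed (simp_all add: p b_gamma_def[symmetric] c_gamma)
  have "VComp ex_A (ncell (\<mu> Gg) u) (wl ex_A (F1 ex_F u) (p (cospan_src u))) = p (cospan_tgt u)"
    "VComp ex_A (wr ex_A (p (cospan_tgt u)) (Id1 ex_A GX)) (ncell (\<mu> Gf) u) = p (cospan_tgt u)" for u
    using A.Id2_VComp[OF cell(1)[of "cospan_tgt u"]] A.VComp_Id2[OF cell(1)[of "cospan_tgt u"]]
      A.HComp_unit_right[OF cell(1)[of "cospan_tgt u"]] cell ends
    by (simp_all add: nat_p \<mu>)
  then show ?thesis
    using nat cell ends
    unfolding is_modification_def Let_def p_def[symmetric]
    by (simp add: gamma_modification_def \<mu>_def[symmetric]) (simp add: \<mu> PiE_def extensional_def)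
qed

lemma cat_isomorphism_surj_Ar:
  assumes "is_cat_isomorphism C D S T" "g \<in> Ar D"
  obtains f where "f \<in> Ar C" "T f = g"
  using assms unfolding is_cat_isomorphism_def is_functor_def by metis

text \<open>The universal property fails at the object \<open>X\<close>, where the comparison
  functor misses \<open>gamma_modification\<close> and so is not surjective on arrows.\<close>

lemma not_pseudo_limit_ex_lambda: "\<not> is_pseudo_limit cospan ex_A ex_F GL ex_lambda"
proof
  let ?D = "hom_cat (Ps cospan ex_A) (\<Delta>0 cospan ex_A GX) ex_F"
  let ?F1 = "\<lambda>\<alpha>. wl (Ps cospan ex_A) ex_lambda (\<Delta>2 cospan ex_A \<alpha>)"
  assume "is_pseudo_limit cospan ex_A ex_F GL ex_lambda"
  then have "is_cat_isomorphism (hom_cat ex_A GX GL) ?D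
      (\<lambda>h. Comp (Ps cospan ex_A) ex_lambda (\<Delta>1 cospan ex_A h)) ?F1"
    by (simp add: is_pseudo_limit_def)
  moreover have "gamma_modification \<in> Ar ?D"
    using is_modification_gamma ex_lambda_comp[of "ex_gen Gf"]
    by (simp add: hom_cat_def Ps_def gamma_modification_def)
  ultimately obtain \<alpha> where "\<alpha> \<in> Ar (hom_cat ex_A GX GL)" and \<alpha>: "?F1 \<alpha> = gamma_modification"
    by (rule cat_isomorphism_surj_Ar)
  then have "\<alpha> \<in> Cell ex_A" "Cod ex_A (Src ex_A \<alpha>) = GL"
    by (simp_all add: hom_cat_def)
  \<comment> \<open>The 2-morphism \<open>\<alpha>\<close> ends over \<open>L\<close>, so its source
    and target agree, and hence so do those of the modification it induces. The components at
    \<open>PtB\<close> contradict this: they are \<open>lambda0 f\<close> and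
    \<open>lambda0 g\<close>, and only the second passes through \<open>g\<close>.\<close>
  then have "msrc (?F1 \<alpha>) = mtgt (?F1 \<alpha>)"
    using ex_cell_into_L by (simp add: Ps_def \<Delta>2_def)
  then have "ncomp (msrc gamma_modification) PtB = ncomp (mtgt gamma_modification) PtB"
    unfolding \<alpha> by simp
  then have "Comp ex_A (ex_gen Glambda0) (ex_gen Gf) = Comp ex_A (ex_gen Glambda0) (ex_gen Gg)"
    by (simp add: gamma_modification_def ex_lambda_comp)
  then have "thru_g (Comp ex_A (ex_gen Glambda0) (ex_gen Gf)) =
      thru_g (Comp ex_A (ex_gen Glambda0) (ex_gen Gg))" by simp
  then show False by simp
qed

theorem mainTheorem10:
  shows "two_terminal (strict_slice cospan ex_A ex_F) (GL, ex_lambda)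
    \<and> \<not> is_pseudo_limit cospan ex_A ex_F GL ex_lambda"
  using two_terminal_ex_lambda not_pseudo_limit_ex_lambda by blast

end
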